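(* Let $(X,d,\ll,\le,\tau)$ be a strongly causal Lorentzian pre-length space with timelike curvature bounded below by some $K\in\mathbb{R}$, and suppose that either (i) every point of $X$ has a relatively compact, causally closed neighborhood $\Omega$ such that for any $p\ll q$ in $\Omega$ there is a maximal future-directed timelike curve from $p$ to $q$ in $\Omega$ that is strictly longer (in $\tau$-length) than any future-directed causal curve from $p$ to $q$ in $\Omega$ that contains a null segment, and there is some $C>0$ bounding the $d$-length of every causal curve in $\Omega$; or (ii) $X$ is timelike locally uniquely geodesic. Then maximal timelike curves in $X$ do not have timelike branching points.
   Context: A causal space $(X,\ll,\le)$: $\le$ reflexive and transitive, $\ll$ transitive, $x\ll y\Rightarrow x\le y$; $x<y$ means $x\le y$, $x\ne y$; $I^+(x)=\{y:x\ll y\}$, $I^-(x)=\{y:y\ll x\}$. A Lorentzian pre-length space $(X,d,\ll,\le,\tau)$ is a causal space with a metric $d$ and $\tau:X\times X\to[0,\infty]$ lower semicontinuous w.r.t. $d$, with $\tau(x,z)\ge\tau(x,y)+\tau(y,z)$ for $x\le y\le z$, $\tau(x,y)=0$ if $x\not\le y$, $\tau(x,y)>0\iff x\ll y$. It is strongly causal if the topology generated by the subbase $\{I^+(x)\cap I^-(y)\}$ equals the metric topology. Future-directed causal (timelike) curve: non-constant, $d$-locally Lipschitz $\gamma:I\to X$ with $\gamma(t_1)\le\gamma(t_2)$ (resp. $\ll$) for $t_1<t_2$; null if no two of its points are $\ll$-related; a curve contains a null segment if its restriction to a non-trivial subinterval is null. $L_\tau(\gamma)=\inf\sum_i\tau(\gamma(t_i),\gamma(t_{i+1}))$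 over partitions of $[a,b]$; $\gamma:[a,b]\to X$ is maximal if $L_\tau(\gamma)=\tau(\gamma(a),\gamma(b))$. A neighborhood $\Omega$ is causally closed if $p_n,q_n\in\Omega$, $p_n\le q_n$, $p_n\to p\in\bar\Omega$, $q_n\to q\in\bar\Omega$ imply $p\le q$. $X$ is timelike locally uniquely geodesic if every point has a neighborhood $U$ such that for $p\ll q$ in $U$ there is a unique maximal future-directed causal curve from $p$ to $q$ in $U$. Model spaces: for $K\in\mathbb{R}$, $M_K$ is the simply connected two-dimensional Lorentzian space form of constant curvature $K$ (covering of the Lorentzian pseudosphere for $K>0$, Minkowski plane for $K=0$, covering of the Lorentzian pseudohyperbolic plane for $K<0$), with time separation $\bar\tau$. Set $\pi/\sqrt K:=\infty$ for $K\le0$. A triple $(a,b,c)$ of positive reals with $c\ge a+b$ satisfies timelike size bounds for $K$ if $c<\pi/\sqrt K$ when $c=a+b$, and $c<\pi/\sqrt{-K}$ when $c>a+b$ and $K<0$; then there is a timelike geodesic triangle in $M_K$ with side lengths $a,b,c$. A timelike geodesic triangle in $X$ is $(x,y,z)$ with $x\ll y\ll z$, $\tau(x,z)<\infty$, and future-directed causal curves $\alpha$ ($x\to y$), $\beta$ ($y\to z$), $\gamma$ ($x\to z$) with $L_\tau(\alpha)=\tau(x,y)$, $L_\tau(\beta)=\tau(y,z)$, $L_\tau(\gamma)=\tau(x,z)$. Given a comparison triangle $(\bar x,\bar y,\bar z)$ in $M_K$ with the same side lengths realized by timelike geodesics $\bar\alpha,\bar\beta,\bar\gamma$, a point $q$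 on $\alpha$ corresponds to $\bar q$ on $\bar\alpha$ if $\tau(x,q)=\bar\tau(\bar x,\bar q)$ (analogously for $\beta$ measured from $y$, and $\gamma$ from $x$). $X$ has timelike curvature bounded below by $K$ if every point has a neighborhood $U$ with: (1) $\tau|_{U\times U}$ finite and continuous; (2) for $x,y\in U$, $x\ll y$, there is a future-directed causal curve $\alpha$ in $U$ with $L_\tau(\alpha)=\tau(x,y)$; (3) for every timelike geodesic triangle $(x,y,z)$ in $U$ realized by maximal causal curves with side lengths satisfying timelike size bounds for $K$, and any comparison triangle in $M_K$, whenever $p,q$ are on sides of $(x,y,z)$ and $\bar p,\bar q$ are corresponding points, $\tau(p,q)\le\bar\tau(\bar p,\bar q)$. Branching: for a maximal causal curve $\gamma:[a,b]\to X$, $x=\gamma(t)$ with $t\in(a,b)$ is a branching point if there exist maximal causal curves $\alpha,\beta:[a,c]\to X$, $c>b$, with $\alpha|_{[a,t]}=\beta|_{[a,t]}=\gamma|_{[a,t]}$ and $\alpha([t,c])\cap\beta([t,c])=\{x\}$; it is a timelike branching point if $\alpha,\beta,\gamma$ are timelike. *)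

theory Defs
  imports "HOL-Analysis.Analysis"
begin

text \<open>The space X is the whole carrier of a type 'a of class metric_space; the metric d is dist.
  ll is the timelike relation, le the causal relation, tau the time separation with values in [0,infinity].\<close>

definition causal_space :: "('a \<Rightarrow> 'a \<Rightarrow> bool) \<Rightarrow> ('a \<Rightarrow> 'a \<Rightarrow> bool) \<Rightarrow> bool" where
  "causal_space ll le \<longleftrightarrow> reflp le \<and> transp le \<and> transp ll \<and> (\<forall>x y. ll x y \<longrightarrow> le x y)"

definition lorentzian_pre_length_space ::
  "('a::metric_space \<Rightarrow> 'a \<Rightarrow> bool) \<Rightarrow> ('a \<Rightarrow> 'a \<Rightarrow> bool) \<Rightarrow> ('a \<Rightarrow> 'a \<Rightarrow> ennreal) \<Rightarrow> bool" where
  "lorentzian_pre_length_space ll le tau \<longleftrightarrow>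
     causal_space ll le \<and>
     (\<forall>c. open {p. c < case_prod tau p}) \<and>
     (\<forall>x y z. le x y \<and> le y z \<longrightarrow> tau x y + tau y z \<le> tau x z) \<and>
     (\<forall>x y. \<not> le x y \<longrightarrow> tau x y = 0) \<and>
     (\<forall>x y. 0 < tau x y \<longleftrightarrow> ll x y)"

definition I_plus :: "('a \<Rightarrow> 'a \<Rightarrow> bool) \<Rightarrow> 'a \<Rightarrow> 'a set" where
  "I_plus ll x = {y. ll x y}"

definition I_minus :: "('a \<Rightarrow> 'a \<Rightarrow> bool) \<Rightarrow> 'a \<Rightarrow> 'a set" where
  "I_minus ll x = {y. ll y x}"

definition strongly_causal :: "('a::metric_space \<Rightarrow> 'a \<Rightarrow> bool) \<Rightarrow> bool" where
  "strongly_causal ll \<longleftrightarrow>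
     topology_generated_by {I_plus ll x \<inter> I_minus ll y | x y. True} = euclidean"

definition loc_lipschitz_on :: "real set \<Rightarrow> (real \<Rightarrow> 'a::metric_space) \<Rightarrow> bool" where
  "loc_lipschitz_on I g \<longleftrightarrow>
     (\<forall>t\<in>I. \<exists>e>0. \<exists>L. lipschitz_on L (I \<inter> {t - e..t + e}) g)"

definition fd_causal_curve ::
  "('a::metric_space \<Rightarrow> 'a \<Rightarrow> bool) \<Rightarrow> (real \<Rightarrow> 'a) \<Rightarrow> real \<Rightarrow> real \<Rightarrow> bool" where
  "fd_causal_curve le g a b \<longleftrightarrow>
     a < b \<and> (\<exists>s\<in>{a..b}. \<exists>t\<in>{a..b}. g s \<noteq> g t) \<and> loc_lipschitz_on {a..b} g \<and>
     (\<forall>s t. a \<le> s \<and> s < t \<and> t \<le> b \<longrightarrow> le (g s) (g t))"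

definition fd_timelike_curve ::
  "('a::metric_space \<Rightarrow> 'a \<Rightarrow> bool) \<Rightarrow> (real \<Rightarrow> 'a) \<Rightarrow> real \<Rightarrow> real \<Rightarrow> bool" where
  "fd_timelike_curve ll g a b \<longleftrightarrow>
     a < b \<and> (\<exists>s\<in>{a..b}. \<exists>t\<in>{a..b}. g s \<noteq> g t) \<and> loc_lipschitz_on {a..b} g \<and>
     (\<forall>s t. a \<le> s \<and> s < t \<and> t \<le> b \<longrightarrow> ll (g s) (g t))"

definition null_curve ::
  "('a::metric_space \<Rightarrow> 'a \<Rightarrow> bool) \<Rightarrow> ('a \<Rightarrow> 'a \<Rightarrow> bool) \<Rightarrow> (real \<Rightarrow> 'a) \<Rightarrow> real \<Rightarrow> real \<Rightarrow> bool" where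
  "null_curve ll le g a b \<longleftrightarrow>
     fd_causal_curve le g a b \<and> (\<forall>s\<in>{a..b}. \<forall>t\<in>{a..b}. \<not> ll (g s) (g t))"

definition contains_null_segment ::
  "('a::metric_space \<Rightarrow> 'a \<Rightarrow> bool) \<Rightarrow> ('a \<Rightarrow> 'a \<Rightarrow> bool) \<Rightarrow> (real \<Rightarrow> 'a) \<Rightarrow> real \<Rightarrow> real \<Rightarrow> bool" where
  "contains_null_segment ll le g a b \<longleftrightarrow>
     (\<exists>s t. a \<le> s \<and> s < t \<and> t \<le> b \<and> null_curve ll le g s t)"

definition partitions :: "real \<Rightarrow> real \<Rightarrow> real list set" where
  "partitions a b = {ts. ts \<noteq> [] \<and> sorted_wrt (<) ts \<and> hd ts = a \<and> last ts = b}"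

definition tau_length :: "('a \<Rightarrow> 'a \<Rightarrow> ennreal) \<Rightarrow> (real \<Rightarrow> 'a) \<Rightarrow> real \<Rightarrow> real \<Rightarrow> ennreal" where
  "tau_length tau g a b =
     Inf {(\<Sum>i<length ts - 1. tau (g (ts ! i)) (g (ts ! (i + 1)))) | ts. ts \<in> partitions a b}"

definition d_length :: "(real \<Rightarrow> 'a::metric_space) \<Rightarrow> real \<Rightarrow> real \<Rightarrow> ennreal" where
  "d_length g a b =
     Sup {(\<Sum>i<length ts - 1. ennreal (dist (g (ts ! i)) (g (ts ! (i + 1))))) | ts. ts \<in> partitions a b}"

definition maximal_curve :: "('a \<Rightarrow> 'a \<Rightarrow> ennreal) \<Rightarrow> (real \<Rightarrow> 'a) \<Rightarrow> real \<Rightarrow> real \<Rightarrow> bool" where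
  "maximal_curve tau g a b \<longleftrightarrow> tau_length tau g a b = tau (g a) (g b)"

text \<open>Points of M_K are pairs of reals (global coordinates of the simply connected model), with the
  Euclidean metric on coordinates (only used for the local Lipschitz condition on curves).
  K > 0: universal cover of 2d de Sitter space of radius r = 1/sqrt K, coordinates (t,theta),
         metric r^2 (-dt^2 + cosh^2 t dtheta^2).
  K = 0: Minkowski plane, coordinates (t,x), metric -dt^2 + dx^2.
  K < 0: universal cover of 2d anti-de Sitter space of radius r = 1/sqrt(-K), coordinates (t,rho),
         metric r^2 (-cosh^2 rho dt^2 + drho^2).
  gd is the Gudermannian function, giving conformally flat coordinates.\<close>

definition gd :: "real \<Rightarrow> real" where
  "gd x = arctan (sinh x)"

definition model_le :: "real \<Rightarrow> real \<times> real \<Rightarrow> real \<times> real \<Rightarrow> bool" where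
  "model_le K p q =
    (if K > 0 then \<bar>snd q - snd p\<bar> \<le> gd (fst q) - gd (fst p)
     else if K = 0 then \<bar>snd q - snd p\<bar> \<le> fst q - fst p
     else \<bar>gd (snd q) - gd (snd p)\<bar> \<le> fst q - fst p)"

definition model_ll :: "real \<Rightarrow> real \<times> real \<Rightarrow> real \<times> real \<Rightarrow> bool" where
  "model_ll K p q =
    (if K > 0 then \<bar>snd q - snd p\<bar> < gd (fst q) - gd (fst p)
     else if K = 0 then \<bar>snd q - snd p\<bar> < fst q - fst p
     else \<bar>gd (snd q) - gd (snd p)\<bar> < fst q - fst p)"

definition model_tau :: "real \<Rightarrow> real \<times> real \<Rightarrow> real \<times> real \<Rightarrow> ennreal" where
  "model_tau K p q =
    (if \<not> model_le K p q then 0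
     else if K > 0 then
       ennreal ((1 / sqrt K) *
         arcosh (cosh (fst p) * cosh (fst q) * cos (snd q - snd p) - sinh (fst p) * sinh (fst q)))
     else if K = 0 then
       ennreal (sqrt ((fst q - fst p)\<^sup>2 - (snd q - snd p)\<^sup>2))
     else if fst q - fst p \<le> pi - \<bar>gd (snd p) + gd (snd q)\<bar> then
       ennreal ((1 / sqrt (- K)) *
         arccos (cosh (snd p) * cosh (snd q) * cos (fst q - fst p) - sinh (snd p) * sinh (snd q)))
     else \<infinity>)"

definition pi_over_sqrt :: "real \<Rightarrow> ereal" where
  "pi_over_sqrt K = (if K > 0 then ereal (pi / sqrt K) else \<infinity>)"

definition timelike_size_bounds :: "real \<Rightarrow> real \<Rightarrow> real \<Rightarrow> real \<Rightarrow> bool" where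
  "timelike_size_bounds K a b c \<longleftrightarrow>
     0 < a \<and> 0 < b \<and> 0 < c \<and> a + b \<le> c \<and>
     (c = a + b \<longrightarrow> ereal c < pi_over_sqrt K) \<and>
     (c > a + b \<and> K < 0 \<longrightarrow> c < pi / sqrt (- K))"

definition timelike_geodesic_triangle ::
  "('a::metric_space \<Rightarrow> 'a \<Rightarrow> bool) \<Rightarrow> ('a \<Rightarrow> 'a \<Rightarrow> bool) \<Rightarrow> ('a \<Rightarrow> 'a \<Rightarrow> ennreal) \<Rightarrow>
   'a \<Rightarrow> 'a \<Rightarrow> 'a \<Rightarrow> (real \<Rightarrow> 'a) \<Rightarrow> real \<Rightarrow> real \<Rightarrow> (real \<Rightarrow> 'a) \<Rightarrow> real \<Rightarrow> real \<Rightarrow>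
   (real \<Rightarrow> 'a) \<Rightarrow> real \<Rightarrow> real \<Rightarrow> bool" where
  "timelike_geodesic_triangle ll le tau x y z al a1 b1 be a2 b2 ga a3 b3 \<longleftrightarrow>
     ll x y \<and> ll y z \<and> tau x z < \<infinity> \<and>
     fd_causal_curve le al a1 b1 \<and> al a1 = x \<and> al b1 = y \<and> tau_length tau al a1 b1 = tau x y \<and>
     fd_causal_curve le be a2 b2 \<and> be a2 = y \<and> be b2 = z \<and> tau_length tau be a2 b2 = tau y z \<and>
     fd_causal_curve le ga a3 b3 \<and> ga a3 = x \<and> ga b3 = z \<and> tau_length tau ga a3 b3 = tau x z"

definition model_comparison_triangle ::
  "real \<Rightarrow> real \<times> real \<Rightarrow> real \<times> real \<Rightarrow> real \<times> real \<Rightarrow>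
   (real \<Rightarrow> real \<times> real) \<Rightarrow> real \<Rightarrow> real \<Rightarrow> (real \<Rightarrow> real \<times> real) \<Rightarrow> real \<Rightarrow> real \<Rightarrow>
   (real \<Rightarrow> real \<times> real) \<Rightarrow> real \<Rightarrow> real \<Rightarrow> bool" where
  "model_comparison_triangle K x y z al a1 b1 be a2 b2 ga a3 b3 \<longleftrightarrow>
     timelike_geodesic_triangle (model_ll K) (model_le K) (model_tau K) x y z al a1 b1 be a2 b2 ga a3 b3 \<and>
     fd_timelike_curve (model_ll K) al a1 b1 \<and>
     fd_timelike_curve (model_ll K) be a2 b2 \<and>
     fd_timelike_curve (model_ll K) ga a3 b3"

definition corresponding ::
  "('a \<Rightarrow> 'a \<Rightarrow> ennreal) \<Rightarrow> real \<Rightarrow>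
   'a \<Rightarrow> 'a \<Rightarrow> (real \<Rightarrow> 'a) \<Rightarrow> real \<Rightarrow> real \<Rightarrow> (real \<Rightarrow> 'a) \<Rightarrow> real \<Rightarrow> real \<Rightarrow>
   (real \<Rightarrow> 'a) \<Rightarrow> real \<Rightarrow> real \<Rightarrow>
   real \<times> real \<Rightarrow> real \<times> real \<Rightarrow>
   (real \<Rightarrow> real \<times> real) \<Rightarrow> real \<Rightarrow> real \<Rightarrow> (real \<Rightarrow> real \<times> real) \<Rightarrow> real \<Rightarrow> real \<Rightarrow>
   (real \<Rightarrow> real \<times> real) \<Rightarrow> real \<Rightarrow> real \<Rightarrow> 'a \<Rightarrow> real \<times> real \<Rightarrow> bool" where
  "corresponding tau K x y al a1 b1 be a2 b2 ga a3 b3 xb yb alb c1 d1 beb c2 d2 gab c3 d3 p pb \<longleftrightarrow>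
     (p \<in> al ` {a1..b1} \<and> pb \<in> alb ` {c1..d1} \<and> tau x p = model_tau K xb pb) \<or>
     (p \<in> be ` {a2..b2} \<and> pb \<in> beb ` {c2..d2} \<and> tau y p = model_tau K yb pb) \<or>
     (p \<in> ga ` {a3..b3} \<and> pb \<in> gab ` {c3..d3} \<and> tau x p = model_tau K xb pb)"

definition neighbourhood :: "'a::topological_space set \<Rightarrow> 'a \<Rightarrow> bool" where
  "neighbourhood U x \<longleftrightarrow> (\<exists>V. open V \<and> x \<in> V \<and> V \<subseteq> U)"

definition timelike_curvature_bounded_below ::
  "('a::metric_space \<Rightarrow> 'a \<Rightarrow> bool) \<Rightarrow> ('a \<Rightarrow> 'a \<Rightarrow> bool) \<Rightarrow> ('a \<Rightarrow> 'a \<Rightarrow> ennreal) \<Rightarrow> real \<Rightarrow> bool" where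
  "timelike_curvature_bounded_below ll le tau K \<longleftrightarrow>
    (\<forall>x0. \<exists>U. neighbourhood U x0 \<and>
      (\<forall>x\<in>U. \<forall>y\<in>U. tau x y < \<infinity>) \<and> continuous_on (U \<times> U) (case_prod tau) \<and>
      (\<forall>x\<in>U. \<forall>y\<in>U. ll x y \<longrightarrow>
         (\<exists>g a b. fd_causal_curve le g a b \<and> g a = x \<and> g b = y \<and> g ` {a..b} \<subseteq> U \<and>
                  tau_length tau g a b = tau x y)) \<and>
      (\<forall>x y z al a1 b1 be a2 b2 ga a3 b3.
         timelike_geodesic_triangle ll le tau x y z al a1 b1 be a2 b2 ga a3 b3 \<and>
         al ` {a1..b1} \<subseteq> U \<and> be ` {a2..b2} \<subseteq> U \<and> ga ` {a3..b3} \<subseteq> U \<and>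
         timelike_size_bounds K (enn2real (tau x y)) (enn2real (tau y z)) (enn2real (tau x z)) \<longrightarrow>
         (\<forall>xb yb zb alb c1 d1 beb c2 d2 gab c3 d3.
            model_comparison_triangle K xb yb zb alb c1 d1 beb c2 d2 gab c3 d3 \<and>
            model_tau K xb yb = tau x y \<and> model_tau K yb zb = tau y z \<and> model_tau K xb zb = tau x z \<longrightarrow>
            (\<forall>p q pb qb.
               corresponding tau K x y al a1 b1 be a2 b2 ga a3 b3 xb yb alb c1 d1 beb c2 d2 gab c3 d3 p pb \<and>
               corresponding tau K x y al a1 b1 be a2 b2 ga a3 b3 xb yb alb c1 d1 beb c2 d2 gab c3 d3 q qb \<longrightarrow>
               tau p q \<le> model_tau K pb qb))))"

definition causally_closed :: "('a::metric_space \<Rightarrow> 'a \<Rightarrow> bool) \<Rightarrow> 'a set \<Rightarrow> bool" where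
  "causally_closed le \<Omega> \<longleftrightarrow>
     (\<forall>P Q p q. (\<forall>n. P n \<in> \<Omega> \<and> Q n \<in> \<Omega> \<and> le (P n) (Q n)) \<and>
        P \<longlonglongrightarrow> p \<and> p \<in> closure \<Omega> \<and> Q \<longlonglongrightarrow> q \<and> q \<in> closure \<Omega> \<longrightarrow> le p q)"

definition condition_i ::
  "('a::metric_space \<Rightarrow> 'a \<Rightarrow> bool) \<Rightarrow> ('a \<Rightarrow> 'a \<Rightarrow> bool) \<Rightarrow> ('a \<Rightarrow> 'a \<Rightarrow> ennreal) \<Rightarrow> bool" where
  "condition_i ll le tau \<longleftrightarrow>
    (\<forall>x0. \<exists>\<Omega>. neighbourhood \<Omega> x0 \<and> compact (closure \<Omega>) \<and> causally_closed le \<Omega> \<and>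
      (\<forall>p\<in>\<Omega>. \<forall>q\<in>\<Omega>. ll p q \<longrightarrow>
         (\<exists>g a b. fd_timelike_curve ll g a b \<and> maximal_curve tau g a b \<and>
                  g a = p \<and> g b = q \<and> g ` {a..b} \<subseteq> \<Omega> \<and>
                  (\<forall>h a' b'. fd_causal_curve le h a' b' \<and> h a' = p \<and> h b' = q \<and>
                     h ` {a'..b'} \<subseteq> \<Omega> \<and> contains_null_segment ll le h a' b' \<longrightarrow>
                     tau_length tau h a' b' < tau_length tau g a b))) \<and>
      (\<exists>C>0. \<forall>h a b. fd_causal_curve le h a b \<and> h ` {a..b} \<subseteq> \<Omega> \<longrightarrow> d_length h a b \<le> ennreal C))"

definition timelike_locally_uniquely_geodesic ::
  "('a::metric_space \<Rightarrow> 'a \<Rightarrow> bool) \<Rightarrow> ('a \<Rightarrow> 'a \<Rightarrow> bool) \<Rightarrow> ('a \<Rightarrow> 'a \<Rightarrow> ennreal) \<Rightarrow> bool" where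
  "timelike_locally_uniquely_geodesic ll le tau \<longleftrightarrow>
    (\<forall>x0. \<exists>U. neighbourhood U x0 \<and>
      (\<forall>p\<in>U. \<forall>q\<in>U. ll p q \<longrightarrow>
         (\<exists>g a b. fd_causal_curve le g a b \<and> maximal_curve tau g a b \<and>
                  g a = p \<and> g b = q \<and> g ` {a..b} \<subseteq> U) \<and>
         (\<forall>g a b h a' b'.
            fd_causal_curve le g a b \<and> maximal_curve tau g a b \<and> g a = p \<and> g b = q \<and> g ` {a..b} \<subseteq> U \<and>
            fd_causal_curve le h a' b' \<and> maximal_curve tau h a' b' \<and> h a' = p \<and> h b' = q \<and> h ` {a'..b'} \<subseteq> U
            \<longrightarrow> g ` {a..b} = h ` {a'..b'})))"

definition timelike_branching_point ::
  "('a::metric_space \<Rightarrow> 'a \<Rightarrow> bool) \<Rightarrow> ('a \<Rightarrow> 'a \<Rightarrow> bool) \<Rightarrow> ('a \<Rightarrow> 'a \<Rightarrow> ennreal) \<Rightarrow>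
   (real \<Rightarrow> 'a) \<Rightarrow> real \<Rightarrow> real \<Rightarrow> real \<Rightarrow> bool" where
  "timelike_branching_point ll le tau g a b t \<longleftrightarrow>
     fd_causal_curve le g a b \<and> maximal_curve tau g a b \<and> a < t \<and> t < b \<and>
     (\<exists>al be c. c > b \<and>
        fd_causal_curve le al a c \<and> maximal_curve tau al a c \<and>
        fd_causal_curve le be a c \<and> maximal_curve tau be a c \<and>
        (\<forall>s\<in>{a..t}. al s = g s \<and> be s = g s) \<and>
        al ` {t..c} \<inter> be ` {t..c} = {g t} \<and>
        fd_timelike_curve ll al a c \<and> fd_timelike_curve ll be a c \<and> fd_timelike_curve ll g a b)"

end

theory Submission
  imports Defs
begin

text \<open>Let the maximal timelike curves \<open>al\<close> and \<open>be\<close> branch at \<open>x\<close>, and take \<open>p\<close> on their common part,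
  \<open>y\<close> on \<open>al\<close> and \<open>z\<close> on \<open>be\<close> beyond \<open>x\<close> with \<open>ll y z\<close>, all close to \<open>x\<close>. In a nondegenerate comparison
  triangle for \<open>(p, y, z)\<close> the point of the side \<open>py\<close> corresponding to \<open>x\<close> has time separation to the third
  vertex strictly less than \<open>tau p z - tau p x = tau x z\<close>, against the curvature bound. Hence
  \<open>tau p z = tau p y + tau y z\<close>, and the curve from \<open>p\<close> along \<open>al\<close> to \<open>y\<close> and on to \<open>z\<close> is maximal.
  If maximal curves are locally unique, \<open>y\<close> lies on \<open>be\<close>, a contradiction. Otherwise let \<open>q\<close> be the infimum
  along \<open>be\<close> of the points \<open>z\<close> with \<open>ll y z\<close>; a limit of causal curves from \<open>y\<close> to such \<open>z\<close>
  is a null curve from \<open>y\<close> to \<open>q\<close>, and \<open>tau p q = tau p y\<close> by continuity, so a maximal curve from \<open>p\<close> to \<open>q\<close>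
  contains a null segment, which condition (i) forbids.\<close>

subsection \<open>Partitions and lengths of curves\<close>

text \<open>The curvature bound says nothing until a comparison triangle is exhibited, so
  nondegenerate triangles are built explicitly in all three model geometries. One side lies on the
  time axis, where the strict inequality for the comparison point is a computation. The bound
  \<delta> on \<open>tau\<close> comes from K < 0: the coordinates used for the geodesics cover
  lengths below pi / (2 sqrt (-K)) only.

  A maximal curve g of finite length is replaced by a real potential F with
  \<open>tau (g s) (g u)\<close> = F u - F s. This removes infinite values, shows at once that all
  subarcs are maximal, and lets maximality of a concatenation be proved by gluing potentials.

  The comparison property and both alternatives are local, while curves may leave a neighbourhood.
  Strong causality supplies a causally convex V, so that every causal curve with end points in V
  stays in V; this also controls the limit curve, of which only the end points are known.

  Under condition (i), additivity of \<open>tau\<close> is available only while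
  \<open>ll y z\<close> holds, and this fails at q. Hence it has to be carried to q by continuity,
  and the curve from y to q has to be produced as a limit.\<close>

lemma psum_snoc:
  fixes f :: "'b \<Rightarrow> 'b \<Rightarrow> 'c::comm_monoid_add"
  assumes "ts \<noteq> []"
  shows "(\<Sum>i<length (ts @ [x]) - 1. f ((ts @ [x]) ! i) ((ts @ [x]) ! (i + 1)))
       = (\<Sum>i<length ts - 1. f (ts ! i) (ts ! (i + 1))) + f (last ts) x"
proof -
  have *: "length (ts @ [x]) - 1 = Suc (length ts - 1)"
    using assms by (cases ts) auto
  have "(\<Sum>i<length ts - 1. f ((ts @ [x]) ! i) ((ts @ [x]) ! (i + 1)))
      = (\<Sum>i<length ts - 1. f (ts ! i) (ts ! (i + 1)))"
    by (intro sum.cong) (auto simp: nth_append)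
  moreover have "f ((ts @ [x]) ! (length ts - 1)) ((ts @ [x]) ! (length ts - 1 + 1)) = f (last ts) x"
    using assms by (auto simp: nth_append last_conv_nth)
  ultimately show ?thesis
    by (simp only: * sum.lessThan_Suc)
qed

lemma hd_le_last_if_strict_sorted:
  fixes ts :: "real list"
  assumes "ts \<noteq> []" "sorted_wrt (<) ts"
  shows "hd ts \<le> last ts"
  using assms by (cases ts) (auto simp: less_imp_le)

text \<open>Every partition sum telescopes to the same value, so the infimum is over a singleton.
  Applied to the explicit model geodesics, to concatenations and to subarcs of maximal curves;
  \<open>maximal_potential\<close> is the converse.\<close>

lemma tau_length_eq_potential:
  fixes F :: "real \<Rightarrow> real"
  assumes ab: "a < b"
    and F: "\<And>s t. a \<le> s \<Longrightarrow> s < t \<Longrightarrow> t \<le> b \<Longrightarrow> F s \<le> F t \<and> tau (g s) (g t) = ennreal (F t - F s)"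
  shows "tau_length tau g a b = ennreal (F b - F a)"
proof -
  \<comment> \<open>The induction removes the last point, so the end of the partition is only
    required to be at most b.\<close>
  have sum: "(\<Sum>i<length ts - 1. tau (g (ts ! i)) (g (ts ! (i + 1)))) = ennreal (F (last ts) - F a)"
    if "ts \<noteq> []" "sorted_wrt (<) ts" "hd ts = a" "last ts \<le> b" for ts
    using that
  proof (induction ts rule: rev_induct)
    case (snoc x ts)
    show ?case
    proof (cases "ts = []")
      case False
      have lt: "last ts < x" using snoc.prems False by (auto simp: sorted_wrt_append)
      have "x \<le> b" using snoc.prems by simp
      with lt have lb: "last ts \<le> b" by linarith
      have al: "a \<le> last ts"
        using hd_le_last_if_strict_sorted[of ts] snoc.prems False by (auto simp: sorted_wrt_append)
      have le: "F a \<le> F (last ts)" using F[of a "last ts"] al lt snoc.prems by (cases "a = last ts") auto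
      have IH: "(\<Sum>i<length ts - 1. tau (g (ts ! i)) (g (ts ! (i + 1)))) = ennreal (F (last ts) - F a)"
        using False lb snoc.prems by (intro snoc.IH) (auto simp: sorted_wrt_append)
      have st: "F (last ts) \<le> F x" "tau (g (last ts)) (g x) = ennreal (F x - F (last ts))"
        using F[OF al lt] snoc.prems by auto
      show ?thesis
        unfolding psum_snoc[OF False, of "\<lambda>u v. tau (g u) (g v)"] IH st(2)
        using le st(1) by (simp flip: ennreal_plus)
    qed (use snoc.prems in auto)
  qed simp
  have ne: "[a, b] \<in> partitions a b"
    using ab by (auto simp: partitions_def)
  have "{(\<Sum>i<length ts - 1. tau (g (ts ! i)) (g (ts ! (i + 1)))) | ts. ts \<in> partitions a b}
      = {ennreal (F b - F a)}"
  proof (intro equalityI subsetI)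
    fix v assume "v \<in> {ennreal (F b - F a)}"
    then show "v \<in> {(\<Sum>i<length ts - 1. tau (g (ts ! i)) (g (ts ! (i + 1)))) | ts. ts \<in> partitions a b}"
      using ne sum[of "[a, b]"] ab by force
  qed (use sum in \<open>auto simp: partitions_def\<close>)
  then show ?thesis unfolding tau_length_def by simp
qed

lemma lipschitz_imp_loc_lipschitz_on:
  "L-lipschitz_on I g \<Longrightarrow> loc_lipschitz_on I g"
  unfolding loc_lipschitz_on_def
  by (metis inf_le1 lipschitz_on_subset zero_less_one)

lemma C1_imp_lipschitz_on:
  fixes f f' :: "real \<Rightarrow> real"
  assumes "\<And>x. x \<in> {a..b} \<Longrightarrow> (f has_field_derivative f' x) (at x within {a..b})"
    and "continuous_on {a..b} f'"
  shows "\<exists>L. L-lipschitz_on {a..b} f"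
proof -
  obtain B where B: "\<And>x. x \<in> {a..b} \<Longrightarrow> norm (f' x) \<le> B"
    using compact_imp_bounded[OF compact_continuous_image[OF assms(2)]] by (auto simp: bounded_iff simp del: atLeastAtMost_iff)
  have "(max B 0)-lipschitz_on {a..b} f"
  proof (rule lipschitz_onI)
    fix x y assume "x \<in> {a..b}" "y \<in> {a..b}"
    then show "dist (f x) (f y) \<le> max B 0 * dist x y"
      using field_differentiable_bound[of "{a..b}" f f' "max B 0" x y] assms(1) B
      by (force simp: dist_norm)
  qed simp
  then show ?thesis by blast
qed

lemma le_last_if_strict_sorted:
  fixes ts :: "real list"
  assumes "sorted_wrt (<) ts" "x \<in> set ts"
  shows "x \<le> last ts"
  using assms by (cases ts rule: rev_cases) (auto simp: sorted_wrt_append less_imp_le)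

lemma psum_append_tl:
  fixes f :: "'b \<Rightarrow> 'b \<Rightarrow> 'c::comm_monoid_add"
  assumes "xs \<noteq> []" "ys \<noteq> []" "last xs = hd ys"
  shows "(\<Sum>i<length (xs @ tl ys) - 1. f ((xs @ tl ys) ! i) ((xs @ tl ys) ! (i + 1)))
       = (\<Sum>i<length xs - 1. f (xs ! i) (xs ! (i + 1))) + (\<Sum>i<length ys - 1. f (ys ! i) (ys ! (i + 1)))"
  using assms(2,3)
proof (induction ys rule: rev_induct)
  case (snoc y ys)
  show ?case
  proof (cases "ys = []")
    case False
    have 1: "xs @ tl (ys @ [y]) = (xs @ tl ys) @ [y]" using False by simp
    have 2: "last (xs @ tl ys) = last ys" using False snoc.prems by (cases ys) auto
    have 3: "xs @ tl ys \<noteq> []" using assms(1) by simp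
    show ?thesis
      unfolding 1 psum_snoc[OF 3] psum_snoc[OF False] 2
      using snoc.IH snoc.prems False by (simp add: add.assoc)
  qed simp
qed simp

text \<open>Bisection: Lipschitz constants on two adjacent intervals combine to their maximum, and
  small intervals around each point are covered by the hypothesis.\<close>

lemma loc_lipschitz_on_imp_lipschitz_on:
  fixes g :: "real \<Rightarrow> 'a::metric_space"
  assumes "loc_lipschitz_on {a..b} g" "a \<le> b"
  shows "\<exists>L. L-lipschitz_on {a..b} g"
proof -
  have "a \<le> a \<longrightarrow> b \<le> b \<longrightarrow> (\<exists>L. L-lipschitz_on {a..b} g)"
  proof (rule Bolzano[where P = "\<lambda>u v. a \<le> u \<longrightarrow> v \<le> b \<longrightarrow> (\<exists>L. L-lipschitz_on {u..v} g)", OF assms(2)])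
    fix u v w
    assume "a \<le> u \<longrightarrow> v \<le> b \<longrightarrow> (\<exists>L. L-lipschitz_on {u..v} g)"
      "a \<le> v \<longrightarrow> w \<le> b \<longrightarrow> (\<exists>L. L-lipschitz_on {v..w} g)" "u \<le> v" "v \<le> w"
    then show "a \<le> u \<longrightarrow> w \<le> b \<longrightarrow> (\<exists>L. L-lipschitz_on {u..w} g)"
      using lipschitz_on_concat_max[of _ u v g _ w g] by auto
  next
    fix x assume "a \<le> x" "x \<le> b"
    then obtain e L where e: "e > 0" and L: "L-lipschitz_on ({a..b} \<inter> {x - e..x + e}) g"
      using assms(1) unfolding loc_lipschitz_on_def by (metis atLeastAtMost_iff)
    have "L-lipschitz_on {u..v} g" if "u \<le> x" "x \<le> v" "v - u < e" "a \<le> u" "v \<le> b" for u v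
      using that by (intro lipschitz_on_subset[OF L]) auto
    then show "\<exists>d>0. \<forall>u v. u \<le> x \<and> x \<le> v \<and> v - u < d \<longrightarrow>
        a \<le> u \<longrightarrow> v \<le> b \<longrightarrow> (\<exists>L. L-lipschitz_on {u..v} g)"
      using e by blast
  qed
  then show ?thesis by simp
qed

lemma fd_causal_curve_lipschitz:
  assumes "fd_causal_curve le g a b"
  obtains L where "L-lipschitz_on {a..b} g"
  using assms loc_lipschitz_on_imp_lipschitz_on[of a b g] unfolding fd_causal_curve_def by force

lemma fd_causal_curve_continuous:
  assumes "fd_causal_curve le g a b"
  shows "continuous_on {a..b} g"
  using fd_causal_curve_lipschitz[OF assms] lipschitz_on_continuous_on by blast

lemma tau_length_le_refined:
  assumes "a \<le> s" "s < u" "u \<le> b"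
  shows "tau_length tau g a b \<le> tau (g a) (g s) + tau (g s) (g u) + tau (g u) (g b)"
proof -
  have "tau_length tau g a b \<le> (\<Sum>i<length ts - 1. tau (g (ts ! i)) (g (ts ! (i + 1))))"
    if "ts \<in> partitions a b" for ts
    unfolding tau_length_def using that by (intro Inf_lower) auto
  note L = this
  \<comment> \<open>Partitions are strictly increasing, so coinciding points must be dropped; the
    terms of the form \<open>tau x x\<close> remaining on the right-hand side are
    nonnegative.\<close>
  consider "a < s" "u < b" | "a = s" "u < b" | "a < s" "u = b" | "a = s" "u = b" using assms by linarith
  then show ?thesis
  proof cases
    case 1
    then show ?thesis using L[of "[a, s, u, b]"] assms
      by (simp add: partitions_def numeral_eq_Suc add.assoc)
  next
    case 2
    then have "tau_length tau g a b \<le> tau (g s) (g u) + tau (g u) (g b)"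
      using L[of "[a, u, b]"] assms by (simp add: partitions_def numeral_eq_Suc)
    also have "\<dots> \<le> tau (g a) (g s) + tau (g s) (g u) + tau (g u) (g b)" by (simp add: add.assoc)
    finally show ?thesis .
  next
    case 3
    then have "tau_length tau g a b \<le> tau (g a) (g s) + tau (g s) (g u)"
      using L[of "[a, s, b]"] assms by (simp add: partitions_def numeral_eq_Suc)
    also have "\<dots> \<le> tau (g a) (g s) + tau (g s) (g u) + tau (g u) (g b)" by simp
    finally show ?thesis .
  next
    case 4
    then have "tau_length tau g a b \<le> tau (g s) (g u)"
      using L[of "[a, b]"] assms by (simp add: partitions_def)
    also have "\<dots> \<le> tau (g a) (g s) + tau (g s) (g u) + tau (g u) (g b)"
      by (simp add: add_increasing add_increasing2)
    finally show ?thesis .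
  qed
qed

subsection \<open>Arc length reparametrization\<close>

lemma d_length_add_dist:
  assumes "a \<le> s" "s < t"
  shows "d_length g a s + ennreal (dist (g s) (g t)) \<le> d_length g a t"
proof -
  let ?S = "\<lambda>ts. \<Sum>i<length ts - 1. ennreal (dist (g (ts ! i)) (g (ts ! (i + 1))))"
  have le: "?S ts + ennreal (dist (g s) (g t)) \<le> d_length g a t" if "ts \<in> partitions a s" for ts
  proof -
    have ts: "ts \<noteq> []" "sorted_wrt (<) ts" "hd ts = a" "last ts = s"
      using that by (auto simp: partitions_def)
    have "x \<le> s" if "x \<in> set ts" for x
      using le_last_if_strict_sorted[OF ts(2) that] ts(4) by simp
    then have "ts @ [t] \<in> partitions a t"
      using ts assms by (force simp: partitions_def sorted_wrt_append)
    then have "?S (ts @ [t]) \<le> d_length g a t"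
      unfolding d_length_def by (intro Sup_upper) blast
    then show ?thesis
      unfolding psum_snoc[OF ts(1), of "\<lambda>u v. ennreal (dist (g u) (g v))"] ts(4) .
  qed
  \<comment> \<open>A constant may be pulled into a supremum only over a nonempty set; for a = s the
    partition is the one-point list.\<close>
  have ne: "{?S ts | ts. ts \<in> partitions a s} \<noteq> {}"
  proof (cases "a = s")
    case True
    then have "[a] \<in> partitions a s" by (simp add: partitions_def)
    then show ?thesis by blast
  next
    case False
    then have "[a, s] \<in> partitions a s" using assms by (simp add: partitions_def)
    then show ?thesis by blast
  qed
  have "d_length g a s + ennreal (dist (g s) (g t))
      = (SUP v \<in> {?S ts | ts. ts \<in> partitions a s}. v + ennreal (dist (g s) (g t)))"
    unfolding d_length_def by (subst ennreal_SUP_add_left[OF ne]) simp_all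
  also have "\<dots> \<le> d_length g a t" using le by (intro SUP_least) auto
  finally show ?thesis .
qed

text \<open>Gives the continuity of arc length as a function of the parameter, on which the
  intermediate value argument in \<open>arclength_reparametrization\<close> rests.\<close>

lemma d_length_lipschitz_bound:
  assumes L: "L-lipschitz_on {a..b} g" and st: "a \<le> s" "s \<le> t" "t \<le> b"
  shows "d_length g a t \<le> d_length g a s + ennreal (L * (t - s))"
proof -
  let ?S = "\<lambda>ts. \<Sum>i<length ts - 1. ennreal (dist (g (ts ! i)) (g (ts ! (i + 1))))"
  have L0: "0 \<le> L" using L lipschitz_on_nonneg by blast
  have dL: "dist (g u) (g v) \<le> L * (v - u)" if "a \<le> u" "u \<le> v" "v \<le> b" for u v
    using lipschitz_onD[OF L, of u v] that by (simp add: dist_real_def)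
  have low: "?S ts \<le> d_length g a s" if "ts \<in> partitions a s" for ts
    unfolding d_length_def using that by (intro Sup_upper) blast
  have "?S ts \<le> d_length g a s + ennreal (L * (last ts - s))"
    if "ts \<noteq> []" "sorted_wrt (<) ts" "hd ts = a" "s \<le> last ts" "last ts \<le> b" for ts
    using that
  proof (induction ts rule: rev_induct)
    case (snoc x ts)
    show ?case
    proof (cases "ts = []")
      case False
      let ?u = "last ts"
      have ts: "sorted_wrt (<) ts" "hd ts = a" "s \<le> x" "x \<le> b" and lt: "\<And>v. v \<in> set ts \<Longrightarrow> v < x"
        using snoc.prems False by (auto simp: sorted_wrt_append)
      have ux: "?u < x" using lt False by simp
      have au: "a \<le> ?u" using hd_le_last_if_strict_sorted[OF False] ts by simp
      have eq: "?S (ts @ [x]) = ?S ts + ennreal (dist (g ?u) (g x))"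
        by (rule psum_snoc[OF False, of "\<lambda>u v. ennreal (dist (g u) (g v))"])
      show ?thesis
      proof (cases "s \<le> ?u")
        case True
        have "?S ts \<le> d_length g a s + ennreal (L * (?u - s))"
          using snoc.IH[OF False] ts True ux by linarith
        moreover have "ennreal (dist (g ?u) (g x)) \<le> ennreal (L * (x - ?u))"
          using dL[OF au] ux ts by (intro ennreal_leI) simp
        ultimately have "?S (ts @ [x]) \<le> d_length g a s + ennreal (L * (?u - s)) + ennreal (L * (x - ?u))"
          unfolding eq by (rule add_mono)
        also have "\<dots> = d_length g a s + ennreal (L * (x - s))"
          using L0 True ux by (simp add: add.assoc flip: ennreal_plus) (simp add: algebra_simps)
        finally show ?thesis by simp
      next
        \<comment> \<open>The last interval straddles s. Cutting it at s leaves a partition of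
          [a, s] and a remainder of length at most L (x - s).\<close>
        case us: False
        have m: "v \<le> ?u" if "v \<in> set ts" for v
          using le_last_if_strict_sorted[OF ts(1) that] .
        have "ts @ [s] \<in> partitions a s"
          using False ts us m by (force simp: partitions_def sorted_wrt_append)
        then have "?S ts + ennreal (dist (g ?u) (g s)) \<le> d_length g a s"
          unfolding psum_snoc[OF False, of "\<lambda>u v. ennreal (dist (g u) (g v))" s, symmetric] by (rule low)
        moreover have "ennreal (dist (g ?u) (g x)) \<le> ennreal (dist (g ?u) (g s)) + ennreal (L * (x - s))"
          using dist_triangle[of "g ?u" "g x" "g s"] dL[of s x] st ts L0
          by (simp add: ennreal_leI flip: ennreal_plus)
        then have "?S ts + ennreal (dist (g ?u) (g x))
            \<le> (?S ts + ennreal (dist (g ?u) (g s))) + ennreal (L * (x - s))"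
          unfolding add.assoc by (rule add_left_mono)
        ultimately have "?S ts + ennreal (dist (g ?u) (g x)) \<le> d_length g a s + ennreal (L * (x - s))"
          by (meson add_right_mono order.trans)
        then show ?thesis using eq by simp
      qed
    qed (use snoc.prems in auto)
  qed simp
  then show ?thesis
    using st unfolding d_length_def[of g a t] by (intro Sup_least) (auto simp: partitions_def)
qed

text \<open>Normalized arc length gives all curves of d-length at most C the same domain [0, 1] and
  the same Lipschitz constant C, as a limit argument requires. \<sigma> merely selects preimages
  under the arc length V and may be neither continuous nor monotone; the composition behaves well
  because g is constant wherever V is.\<close>

lemma arclength_reparametrization:
  fixes g :: "real \<Rightarrow> 'a::metric_space"
  assumes g: "fd_causal_curve le g a b" and C: "d_length g a b \<le> ennreal C" "0 \<le> C" and refl: "reflp le"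
  obtains \<sigma> :: "real \<Rightarrow> real" where "\<And>q. q \<in> {0..1} \<Longrightarrow> \<sigma> q \<in> {a..b}" "C-lipschitz_on {0..1} (\<lambda>q. g (\<sigma> q))"
    "g (\<sigma> 0) = g a" "g (\<sigma> 1) = g b"
    "\<And>q r. 0 \<le> q \<Longrightarrow> q \<le> r \<Longrightarrow> r \<le> 1 \<Longrightarrow> le (g (\<sigma> q)) (g (\<sigma> r))"
proof -
  have ab: "a < b" using g by (simp add: fd_causal_curve_def)
  obtain L where L: "L-lipschitz_on {a..b} g" by (rule fd_causal_curve_lipschitz[OF g])
  have L0: "0 \<le> L" using L lipschitz_on_nonneg by blast
  have mono: "d_length g a s \<le> d_length g a t" if "a \<le> s" "s \<le> t" for s t
  proof (cases "s = t")
    case False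
    have "d_length g a s \<le> d_length g a s + ennreal (dist (g s) (g t))" by simp
    also have "\<dots> \<le> d_length g a t" using d_length_add_dist[of a s t g] that False by simp
    finally show ?thesis .
  qed simp
  have fin: "d_length g a t < \<infinity>" if "a \<le> t" "t \<le> b" for t
    using mono[OF that] C(1) by (metis ennreal_less_top infinity_ennreal_def order_le_less_trans)
  define V where "V t = enn2real (d_length g a t)" for t
  have V: "d_length g a t = ennreal (V t)" "0 \<le> V t" if "a \<le> t" "t \<le> b" for t
    using fin[OF that] by (auto simp: V_def)
  have dist_V: "V s + dist (g s) (g t) \<le> V t" if "a \<le> s" "s \<le> t" "t \<le> b" for s t
  proof (cases "s = t")
    case False
    then show ?thesis using d_length_add_dist[of a s t g] that V[of s] V[of t]
      by (simp flip: ennreal_plus)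
  qed simp
  have V_lip: "V t \<le> V s + L * (t - s)" if "a \<le> s" "s \<le> t" "t \<le> b" for s t
    using d_length_lipschitz_bound[OF L that] that V[of s] V[of t] L0
    by (simp flip: ennreal_plus)
  have "L-lipschitz_on {a..b} V"
  proof (rule lipschitz_on_leI)
    fix s t assume "s \<in> {a..b}" "t \<in> {a..b}" "s \<le> t"
    then show "dist (V s) (V t) \<le> L * dist s t"
      using V_lip[of s t] dist_V[of s t] by (simp add: dist_real_def abs_if)
        (smt (verit) zero_le_dist)
  qed (rule L0)
  then have cont: "continuous_on {a..b} V" by (rule lipschitz_on_continuous_on)
  have Va: "V a = 0"
  proof -
    have "ts = [a]" if "ts \<in> partitions a a" for ts
    proof (cases ts)
      case (Cons x xs)
      then show ?thesis using that by (cases "xs = []") (auto simp: partitions_def)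
    qed (use that in \<open>simp add: partitions_def\<close>)
    then have "partitions a a = {[a]}" by (auto simp: partitions_def)
    then have "d_length g a a = 0" by (simp add: d_length_def)
    then show ?thesis by (simp add: V_def)
  qed
  have Vb: "0 \<le> V b" "V b \<le> C" using V[of b] ab C by auto
  have "\<exists>t\<in>{a..b}. V t = q * V b" if q: "q \<in> {0..1}" for q
  proof -
    have "0 \<le> q * V b" "q * V b \<le> V b" using q Vb by (auto simp: mult_left_le_one_le)
    then show ?thesis using IVT'[of V a "q * V b" b] cont ab Va by auto
  qed
  then obtain \<sigma> where \<sigma>: "\<And>q. q \<in> {0..1} \<Longrightarrow> \<sigma> q \<in> {a..b} \<and> V (\<sigma> q) = q * V b" by metis
  have dist_\<sigma>: "dist (g s) (g t) \<le> \<bar>V t - V s\<bar>" if "s \<in> {a..b}" "t \<in> {a..b}" for s t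
    using that dist_V[of s t] dist_V[of t s] by (cases "s \<le> t") (auto simp: dist_commute)
  show thesis
  proof (rule that[of \<sigma>])
    show "\<sigma> q \<in> {a..b}" if "q \<in> {0..1}" for q using \<sigma>[OF that] by simp
    show "C-lipschitz_on {0..1} (\<lambda>q. g (\<sigma> q))"
    proof (rule lipschitz_onI)
      fix q r :: real assume qr: "q \<in> {0..1}" "r \<in> {0..1}"
      have "dist (g (\<sigma> q)) (g (\<sigma> r)) \<le> \<bar>r * V b - q * V b\<bar>"
        using dist_\<sigma>[of "\<sigma> q" "\<sigma> r"] \<sigma>[OF qr(1)] \<sigma>[OF qr(2)] by simp
      also have "\<dots> = V b * dist q r"
        using Vb by (simp add: dist_real_def abs_mult abs_minus_commute flip: left_diff_distrib)
      also have "\<dots> \<le> C * dist q r" using Vb by (intro mult_right_mono) auto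
      finally show "dist (g (\<sigma> q)) (g (\<sigma> r)) \<le> C * dist q r" .
    qed (rule C)
    show "g (\<sigma> 0) = g a" using dist_\<sigma>[of "\<sigma> 0" a] \<sigma>[of 0] ab Va by simp
    show "g (\<sigma> 1) = g b" using dist_\<sigma>[of "\<sigma> 1" b] \<sigma>[of 1] ab by simp
    fix q r :: real assume qr: "0 \<le> q" "q \<le> r" "r \<le> 1"
    show "le (g (\<sigma> q)) (g (\<sigma> r))"
    proof (cases "\<sigma> q < \<sigma> r")
      case True
      then show ?thesis using g \<sigma>[of q] \<sigma>[of r] qr by (auto simp: fd_causal_curve_def)
    next
      case False
      \<comment> \<open>If \<sigma> reverses the order of q and r, then V agrees at both values, so
        the two points of g coincide and reflexivity applies.\<close>
      have "V (\<sigma> q) \<le> V (\<sigma> r)" using \<sigma>[of q] \<sigma>[of r] qr Vb by (simp add: mult_right_mono)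
      moreover have "V (\<sigma> r) + dist (g (\<sigma> r)) (g (\<sigma> q)) \<le> V (\<sigma> q)"
        using dist_V[of "\<sigma> r" "\<sigma> q"] False \<sigma>[of q] \<sigma>[of r] qr by simp
      ultimately have "dist (g (\<sigma> r)) (g (\<sigma> q)) \<le> 0" by linarith
      then show ?thesis using refl by (simp add: reflp_def)
    qed
  qed
qed

subsection \<open>Triangles in the model spaces\<close>

lemma gd_bounds: "\<bar>gd x\<bar> < pi / 2"
  using arctan_lbound[of "sinh x"] arctan_ubound[of "sinh x"] by (simp add: gd_def abs_if)

lemma gd_less_iff [simp]: "gd x < gd y \<longleftrightarrow> x < y"
  by (simp add: gd_def arctan_less_iff)

lemma cos_gd: "cos (gd x) = 1 / cosh x"
proof -
  have "sqrt (1 + (sinh x)\<^sup>2) = cosh x"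
    by (metis add.commute cosh_arsinh_real arsinh_sinh_real)
  then show ?thesis by (simp add: gd_def cos_arctan)
qed

lemma sin_gd: "sin (gd x) = sinh x / cosh x"
proof -
  have "sqrt (1 + (sinh x)\<^sup>2) = cosh x"
    by (metis add.commute cosh_arsinh_real arsinh_sinh_real)
  then show ?thesis by (simp add: gd_def sin_arctan)
qed

text \<open>Links the light cones, which are straight in the coordinate \<open>gd\<close>, with the
  ambient scalar product of points on the hyperboloid: the cone is where the product is 1. In the
  same way \<open>cos_gd_add\<close> describes the value -1, which bounds the arccos case of
  \<open>model_tau\<close> for K < 0.\<close>

lemma cos_gd_diff: "cosh x * cosh y * cos (gd x - gd y) = 1 + sinh x * sinh y"
  by (simp add: cos_diff cos_gd sin_gd field_simps)

lemma cos_gd_add: "cosh x * cosh y * cos (gd x + gd y) = 1 - sinh x * sinh y"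
  by (simp add: cos_add cos_gd sin_gd field_simps)

text \<open>The parameter is the length in the model of curvature 1, 0 or -1. The factor k restores
  the true length: it is the radius 1 / sqrt |K| of the model, and 1 for the Minkowski
  plane.\<close>

definition model_segment ::
  "real \<Rightarrow> real \<Rightarrow> real \<times> real \<Rightarrow> real \<times> real \<Rightarrow> (real \<Rightarrow> real \<times> real) \<Rightarrow> real \<Rightarrow> bool" where
  "model_segment K k x y g l \<longleftrightarrow> 0 < l \<and> g 0 = x \<and> g l = y \<and> (\<exists>L. L-lipschitz_on {0..l} g) \<and>
     (\<forall>s t. 0 \<le> s \<and> s < t \<and> t \<le> l \<longrightarrow>
        model_ll K (g s) (g t) \<and> model_tau K (g s) (g t) = ennreal (k * (t - s)))"

lemma model_ll_imp_le: "model_ll K p q \<Longrightarrow> model_le K p q"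
  by (auto simp: model_ll_def model_le_def split: if_splits)

lemma model_segment_props:
  assumes "model_segment K k x y g l" "0 < k"
  shows "0 < l" "g 0 = x" "g l = y" "model_ll K x y" "model_tau K x y = ennreal (k * l)"
    "fd_timelike_curve (model_ll K) g 0 l" "fd_causal_curve (model_le K) g 0 l"
    "tau_length (model_tau K) g 0 l = model_tau K x y"
proof -
  have l: "0 < l" "g 0 = x" "g l = y" and lip: "loc_lipschitz_on {0..l} g"
    and st: "\<And>s t. 0 \<le> s \<Longrightarrow> s < t \<Longrightarrow> t \<le> l \<Longrightarrow>
        model_ll K (g s) (g t) \<and> model_tau K (g s) (g t) = ennreal (k * (t - s))"
    using assms(1) lipschitz_imp_loc_lipschitz_on unfolding model_segment_def by blast+
  show "0 < l" "g 0 = x" "g l = y" by fact+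
  show ll: "model_ll K x y" and tau: "model_tau K x y = ennreal (k * l)"
    using st[of 0 l] l by auto
  have "\<not> model_ll K x x" by (simp add: model_ll_def)
  with ll have "x \<noteq> y" by auto
  then have "\<exists>s\<in>{0..l}. \<exists>t\<in>{0..l}. g s \<noteq> g t"
    using l by (intro bexI[of _ 0] bexI[of _ l]) auto
  then show "fd_timelike_curve (model_ll K) g 0 l" "fd_causal_curve (model_le K) g 0 l"
    using l lip st model_ll_imp_le unfolding fd_timelike_curve_def fd_causal_curve_def by blast+
  show "tau_length (model_tau K) g 0 l = model_tau K x y"
    using tau_length_eq_potential[of 0 l "\<lambda>s. k * s" "model_tau K" g] l st tau assms(2)
    by (simp add: algebra_simps)
qed

lemma model_comparison_triangle_segments:
  assumes "0 < k" "model_segment K k x y f a" "model_segment K k y z g b" "model_segment K k x z h c"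
  shows "model_comparison_triangle K x y z f 0 a g 0 b h 0 c"
  using model_segment_props[OF assms(2,1)] model_segment_props[OF assms(3,1)]
    model_segment_props[OF assms(4,1)]
  unfolding model_comparison_triangle_def timelike_geodesic_triangle_def by simp

text \<open>One triangle suffices, since the curvature bound applies to every comparison triangle.
  Here p is the comparison point of the branching point on the first side, and c - u is the
  separation that the branching point has from the third vertex in X.\<close>

definition strict_model_triangle :: "real \<Rightarrow> real \<Rightarrow> real \<Rightarrow> real \<Rightarrow> real \<Rightarrow> bool" where
  "strict_model_triangle K a b c u \<longleftrightarrow>
     (\<exists>x y z p f a' g b' h c'. model_comparison_triangle K x y z f 0 a' g 0 b' h 0 c' \<and>
        model_tau K x y = ennreal a \<and> model_tau K y z = ennreal b \<and> model_tau K x z = ennreal c \<and>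
        p \<in> f ` {0..a'} \<and> model_tau K x p = ennreal u \<and> model_tau K p z < ennreal (c - u))"

lemma strict_model_triangleI:
  assumes k: "0 < k" and seg: "model_segment K k x y f a" "model_segment K k y z g b"
      "model_segment K k x z h c"
    and u: "0 < u" "u < a" and less: "model_tau K (f u) z < ennreal (k * (c - u))"
  shows "strict_model_triangle K (k * a) (k * b) (k * c) (k * u)"
proof -
  have "model_tau K x (f u) = ennreal (k * u)"
    using seg(1) u unfolding model_segment_def by (metis diff_zero less_imp_le order_refl)
  moreover have "f u \<in> f ` {0..a}" using u by auto
  ultimately show ?thesis
    using model_comparison_triangle_segments[OF k seg] model_segment_props(5)[OF seg(1) k]
      model_segment_props(5)[OF seg(2) k] model_segment_props(5)[OF seg(3) k] less
    unfolding strict_model_triangle_def right_diff_distrib by blast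
qed

subsection \<open>Minkowski plane\<close>

lemma minkowski_segment:
  assumes l: "0 < l" "0 < T" "T\<^sup>2 - X\<^sup>2 = l\<^sup>2"
  shows "model_segment 0 1 (t0, 0) (t0 + T, X) (\<lambda>s. (t0 + s * (T / l), s * (X / l))) l"
  unfolding model_segment_def
proof (intro conjI allI impI)
  have "\<exists>L. L-lipschitz_on {0..l} (\<lambda>s. t0 + s * (T / l))"
    by (rule C1_imp_lipschitz_on[where f' = "\<lambda>_. T / l"])
      (use l in \<open>auto intro!: derivative_eq_intros continuous_intros\<close>)
  moreover have "\<exists>L. L-lipschitz_on {0..l} (\<lambda>s. s * (X / l))"
    by (rule C1_imp_lipschitz_on[where f' = "\<lambda>_. X / l"])
      (use l in \<open>auto intro!: derivative_eq_intros continuous_intros\<close>)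
  ultimately show "\<exists>L. L-lipschitz_on {0..l} (\<lambda>s. (t0 + s * (T / l), s * (X / l)))"
    using lipschitz_on_Pair by blast
  have "X\<^sup>2 < T\<^sup>2" using l(3) zero_less_power[OF l(1), of 2] by linarith
  then have XT: "\<bar>X\<bar> < T" using l power2_less_imp_less[of "\<bar>X\<bar>" T] by simp
  fix s t assume st: "0 \<le> s \<and> s < t \<and> t \<le> l"
  let ?p = "(t0 + s * (T / l), s * (X / l))" and ?q = "(t0 + t * (T / l), t * (X / l))"
  have d: "snd ?q - snd ?p = (t - s) / l * X" "fst ?q - fst ?p = (t - s) / l * T"
    using l by (auto simp: field_simps)
  show ll: "model_ll 0 ?p ?q"
    unfolding model_ll_def d using XT st l by (auto simp: abs_mult intro!: divide_strict_right_mono)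
  have "((t - s) / l * T)\<^sup>2 - ((t - s) / l * X)\<^sup>2 = ((t - s) / l)\<^sup>2 * (T\<^sup>2 - X\<^sup>2)"
    by (simp only: power_mult_distrib right_diff_distrib)
  also have "\<dots> = (t - s)\<^sup>2" using l by (simp add: power_divide)
  finally have "sqrt (((t - s) / l * T)\<^sup>2 - ((t - s) / l * X)\<^sup>2) = t - s" using st by simp
  then show "model_tau 0 ?p ?q = ennreal (1 * (t - s))"
    unfolding model_tau_def d using model_ll_imp_le[OF ll] by simp
qed (use l in auto)

text \<open>The configuration is the same in all three models: the side of length a runs from the
  origin along the time axis, and a + b < c pushes z off the axis. This makes one coordinate of z
  exceed the value it would have on the axis, which lowers the separation from (u, 0) to z below c -
  u.\<close>

lemma minkowski_triangle:
  assumes "0 < a" "0 < b" "a + b < c" "0 < u" "u < a"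
  shows "strict_model_triangle 0 a b c u"
proof -
  \<comment> \<open>T and X solve T^2 - X^2 = c^2 and (T - a)^2 - X^2 = b^2, the length conditions
    for the two sides ending at (T, X).\<close>
  define T where "T = (c\<^sup>2 + a\<^sup>2 - b\<^sup>2) / (2 * a)"
  have "b\<^sup>2 < (c - a)\<^sup>2" using assms by (intro power_strict_mono) auto
  then have T: "c < T" using assms by (simp add: T_def field_simps power2_eq_square)
  define X where "X = sqrt (T\<^sup>2 - c\<^sup>2)"
  have "c\<^sup>2 < T\<^sup>2" using T assms by (intro power_strict_mono) auto
  then have X: "X\<^sup>2 = T\<^sup>2 - c\<^sup>2" by (simp add: X_def)
  have aT: "2 * a * T = c\<^sup>2 + a\<^sup>2 - b\<^sup>2" using assms by (simp add: T_def)
  have 1: "model_segment 0 1 (0, 0) (a, 0) (\<lambda>s. (0 + s * (a / a), s * (0 / a))) a"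
    using minkowski_segment[of a a 0 0] assms by simp
  have "(T - a)\<^sup>2 - X\<^sup>2 = b\<^sup>2" unfolding X using aT by (simp add: power2_diff mult.commute mult.left_commute)
  then have 2: "model_segment 0 1 (a, 0) (T, X) (\<lambda>s. (a + s * ((T - a) / b), s * (X / b))) b"
    using minkowski_segment[of b "T - a" X a] assms T by simp
  have 3: "model_segment 0 1 (0, 0) (T, X) (\<lambda>s. (0 + s * (T / c), s * (X / c))) c"
    using minkowski_segment[of c T X 0] assms T X by simp
  have "(T - u)\<^sup>2 - X\<^sup>2 = c\<^sup>2 - 2 * u * T + u\<^sup>2" unfolding X by (simp add: power2_diff)
  also have "\<dots> < (c - u)\<^sup>2" using T assms by (simp add: power2_diff)
  finally have "sqrt ((T - u)\<^sup>2 - X\<^sup>2) < c - u"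
    using assms by (intro real_less_lsqrt) auto
  then have "model_tau 0 (u, 0) (T, X) < ennreal (c - u)"
    using assms by (auto simp: model_tau_def ennreal_lessI)
  then show ?thesis
    using strict_model_triangleI[OF _ 1 2 3, of u] assms by simp
qed

subsection \<open>De Sitter plane\<close>

lemma de_sitter_ll:
  assumes "0 < K" "t1 < t2" "\<bar>x2 - x1\<bar> \<le> pi"
    and "1 < cosh t1 * cosh t2 * cos (x2 - x1) - sinh t1 * sinh t2"
  shows "model_ll K (t1, x1) (t2, x2)"
proof -
  have "cosh t2 * cosh t1 * cos (gd t2 - gd t1) < cosh t2 * cosh t1 * cos (x2 - x1)"
    unfolding cos_gd_diff using assms(4) by (simp add: mult.commute)
  then have "cos (gd t2 - gd t1) < cos \<bar>x2 - x1\<bar>" by simp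
  moreover have "0 \<le> gd t2 - gd t1" "gd t2 - gd t1 \<le> pi"
    using assms(2) gd_less_iff[of t1 t2] gd_bounds[of t1] gd_bounds[of t2] by linarith+
  ultimately have "\<bar>x2 - x1\<bar> < gd t2 - gd t1"
    using cos_mono_less_eq[of "gd t2 - gd t1" "\<bar>x2 - x1\<bar>"] assms(3) by auto
  then show ?thesis using assms(1) by (simp add: model_ll_def)
qed

lemma de_sitter_le_product:
  assumes "0 < K" "model_le K (t1, x1) (t2, x2)"
  shows "1 \<le> cosh t1 * cosh t2 * cos (x2 - x1) - sinh t1 * sinh t2"
proof -
  have le: "\<bar>x2 - x1\<bar> \<le> gd t2 - gd t1" using assms by (simp add: model_le_def)
  have "gd t2 - gd t1 \<le> pi"
    using gd_bounds[of t1] gd_bounds[of t2] by linarith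
  then have "cos (gd t2 - gd t1) \<le> cos (x2 - x1)"
    using cos_monotone_0_pi_le[OF _ le] by auto
  then have "cosh t2 * cosh t1 * cos (gd t2 - gd t1) \<le> cosh t2 * cosh t1 * cos (x2 - x1)"
    by (intro mult_left_mono) auto
  then show ?thesis unfolding cos_gd_diff by (simp add: mult.commute)
qed

text \<open>Inverts the embedding (sinh t, cosh t cos \<theta>, cosh t sin \<theta>) of the
  hyperboloid. The function arctan covers only the half m > 0, so the geodesics below are kept
  there. The anti-de Sitter case uses it too, with the roles of time and space exchanged.\<close>

lemma cosh_cos_sin_of_embedding:
  fixes n m e :: real
  assumes "m\<^sup>2 + e\<^sup>2 = n\<^sup>2 + 1" "0 < m"
  shows "cosh (arsinh n) * cos (arctan (e / m)) = m" "cosh (arsinh n) * sin (arctan (e / m)) = e"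
proof -
  have "1 + (e / m)\<^sup>2 = (n\<^sup>2 + 1) / m\<^sup>2"
    using assms by (simp add: power_divide add_divide_distrib[symmetric] field_simps)
  then have "sqrt (1 + (e / m)\<^sup>2) = sqrt (n\<^sup>2 + 1) / m"
    using assms(2) by (simp add: real_sqrt_divide)
  moreover have "0 < sqrt (n\<^sup>2 + 1)" by (simp add: add_nonneg_pos)
  ultimately show "cosh (arsinh n) * cos (arctan (e / m)) = m" "cosh (arsinh n) * sin (arctan (e / m)) = e"
    using assms(2) unfolding cosh_arsinh_real cos_arctan sin_arctan by (auto simp: field_simps)
qed

text \<open>A timelike geodesic is cosh s P + sinh s Q with P the starting point and Q a unit
  tangent at P. \<open>prod\<close> says that the end points are at distance l, and
  \<open>fut\<close> makes the tangent future-directed.\<close>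

lemma de_sitter_segment:
  assumes K: "0 < K" and A: "0 \<le> A" and l: "0 < l" and th: "\<bar>\<theta>\<bar> < pi / 2"
    and prod: "cosh A * cosh T * cos \<theta> - sinh A * sinh T = cosh l"
    and fut: "sinh A * cosh T * cos \<theta> < sinh T * cosh A"
  shows "\<exists>g. model_segment K (1 / sqrt K) (A, 0) (T, \<theta>) g l"
proof -
  \<comment> \<open>In the ambient coordinates (n, m, e), P is (sinh A, cosh A, 0) and Q is (w cosh
    A, w sinh A, v). The values of v and w are forced by the end point at s = l, and Q being a unit
    vector means w^2 - v^2 = 1. With w > 0 and 0 \<le> A, m stays positive and n increases.\<close>
  define v where "v = cosh T * sin \<theta> / sinh l"
  define w where "w = (sinh T * cosh A - sinh A * cosh T * cos \<theta>) / sinh l"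
  define n where "n s = cosh s * sinh A + w * sinh s * cosh A" for s
  define m where "m s = cosh s * cosh A + w * sinh s * sinh A" for s
  define e where "e s = v * sinh s" for s
  have sl: "0 < sinh l" using l by simp
  have w0: "0 < w" using fut sl by (simp add: w_def)
  have hA: "(cosh A)\<^sup>2 = (sinh A)\<^sup>2 + 1" and hT: "(cosh T)\<^sup>2 = (sinh T)\<^sup>2 + 1"
    and hl: "(cosh l)\<^sup>2 = (sinh l)\<^sup>2 + 1"
    by (simp_all add: cosh_square_eq)
  have th2: "(cos \<theta>)\<^sup>2 + (sin \<theta>)\<^sup>2 = 1" by simp
  have "(sinh T * cosh A - sinh A * cosh T * cos \<theta>)\<^sup>2 - (cosh T * sin \<theta>)\<^sup>2 = (sinh l)\<^sup>2"
    using hA hT hl th2 prod by algebra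
  then have "(sinh l)\<^sup>2 * (w\<^sup>2 - v\<^sup>2) = (sinh l)\<^sup>2 * 1"
    using sl by (simp add: w_def v_def power_divide field_simps)
  then have wv: "w\<^sup>2 - v\<^sup>2 = 1" using sl mult_cancel_left[of "(sinh l)\<^sup>2"] by simp
  have m0: "0 < m s" if "0 \<le> s" for s
    using that A w0 unfolding m_def by (intro add_pos_nonneg) auto
  have emb: "(m s)\<^sup>2 + (e s)\<^sup>2 = (n s)\<^sup>2 + 1" for s
  proof -
    have "(cosh s)\<^sup>2 = (sinh s)\<^sup>2 + 1" by (simp add: cosh_square_eq)
    then show ?thesis unfolding m_def e_def n_def using hA wv by algebra
  qed
  have prod_st: "m s * m t + e s * e t - n s * n t = cosh (t - s)" for s t
    unfolding cosh_diff m_def e_def n_def using hA wv by algebra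
  define g where "g s = (arsinh (n s), arctan (e s / m s))" for s
  \<comment> \<open>The left-hand side is the ambient scalar product of the two points. Its value
    cosh (t - s) decides both the causal relation and the time separation along g.\<close>
  have P: "cosh (fst (g s)) * cosh (fst (g t)) * cos (snd (g t) - snd (g s)) - sinh (fst (g s)) * sinh (fst (g t))
      = cosh (t - s)" if "0 \<le> s" "0 \<le> t" for s t
  proof -
    note cs = cosh_cos_sin_of_embedding[OF emb[of s] m0[OF that(1)]]
      cosh_cos_sin_of_embedding[OF emb[of t] m0[OF that(2)]]
    have "cosh (fst (g s)) * cosh (fst (g t)) * cos (snd (g t) - snd (g s)) =
        (cosh (arsinh (n s)) * cos (arctan (e s / m s))) * (cosh (arsinh (n t)) * cos (arctan (e t / m t)))
      + (cosh (arsinh (n s)) * sin (arctan (e s / m s))) * (cosh (arsinh (n t)) * sin (arctan (e t / m t)))"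
      by (simp add: g_def cos_diff algebra_simps)
    then show ?thesis unfolding cs using prod_st[of s t] by (simp add: g_def)
  qed
  have "model_segment K (1 / sqrt K) (A, 0) (T, \<theta>) g l"
    unfolding model_segment_def
  proof (intro conjI allI impI)
    show "g 0 = (A, 0)" by (simp add: g_def n_def e_def arsinh_sinh_real)
    have nl: "n l = sinh T"
    proof -
      have "w * sinh l = sinh T * cosh A - sinh A * cosh T * cos \<theta>" using sl by (simp add: w_def)
      then show ?thesis unfolding n_def prod[symmetric] using hA by algebra
    qed
    have ml: "m l = cosh T * cos \<theta>"
    proof -
      have "w * sinh l = sinh T * cosh A - sinh A * cosh T * cos \<theta>" using sl by (simp add: w_def)
      then show ?thesis unfolding m_def prod[symmetric] using hA by algebra
    qed
    have el: "e l = cosh T * sin \<theta>" using sl by (simp add: e_def v_def)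
    have "e l / m l = tan \<theta>" unfolding ml el tan_def by simp
    then have "arctan (e l / m l) = \<theta>" using arctan_tan[of \<theta>] th by (auto simp: abs_less_iff)
    then show "g l = (T, \<theta>)" by (simp add: g_def nl arsinh_sinh_real)
    have "\<exists>L. L-lipschitz_on {0..l} (\<lambda>s. arsinh (n s))"
      unfolding n_def
    proof (rule C1_imp_lipschitz_on[where f' = "\<lambda>s. 1 / sqrt ((cosh s * sinh A + w * sinh s * cosh A)\<^sup>2 + 1)
            * (sinh s * sinh A + w * cosh s * cosh A)"])
      fix s
      have "((\<lambda>s. cosh s * sinh A + w * sinh s * cosh A) has_real_derivative sinh s * sinh A + w * cosh s * cosh A)
          (at s within {0..l})"
        by (auto intro!: derivative_eq_intros)
      then show "((\<lambda>s. arsinh (cosh s * sinh A + w * sinh s * cosh A)) has_real_derivative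
          1 / sqrt ((cosh s * sinh A + w * sinh s * cosh A)\<^sup>2 + 1) * (sinh s * sinh A + w * cosh s * cosh A))
          (at s within {0..l})"
        by (rule DERIV_chain2[OF arsinh_real_has_field_derivative])
    qed (auto intro!: continuous_intros simp: add_nonneg_pos less_imp_neq[THEN not_sym])
    moreover have "\<exists>L. L-lipschitz_on {0..l} (\<lambda>s. arctan (e s / m s))"
    proof (rule C1_imp_lipschitz_on[where f' = "\<lambda>s. ((v * cosh s) * m s - e s * (sinh s * cosh A + w * cosh s * sinh A))
            / (m s * m s) / (1 + (e s / m s)\<^sup>2)"])
      fix s assume s: "s \<in> {0..l}"
      then have ms: "m s \<noteq> 0" using m0[of s] by simp
      have "(m has_field_derivative (sinh s * cosh A + w * cosh s * sinh A)) (at s within {0..l})"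
        unfolding m_def by (auto intro!: derivative_eq_intros)
      moreover have "(e has_field_derivative (v * cosh s)) (at s within {0..l})"
        unfolding e_def by (auto intro!: derivative_eq_intros)
      ultimately show "((\<lambda>s. arctan (e s / m s)) has_field_derivative
          ((v * cosh s) * m s - e s * (sinh s * cosh A + w * cosh s * sinh A)) / (m s * m s) / (1 + (e s / m s)\<^sup>2))
          (at s within {0..l})"
        using ms by (auto intro!: derivative_eq_intros simp: field_simps)
    next
      have "continuous_on {0..l} m" "continuous_on {0..l} e"
        unfolding m_def e_def by (auto intro!: continuous_intros)
      moreover have "m s \<noteq> 0" if "s \<in> {0..l}" for s using m0[of s] that by simp
      moreover have "1 + (e s / m s)\<^sup>2 \<noteq> 0" for s
        by (metis add_pos_nonneg less_irrefl zero_le_power2 zero_less_one)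
      ultimately show "continuous_on {0..l} (\<lambda>s. ((v * cosh s) * m s - e s * (sinh s * cosh A + w * cosh s * sinh A))
            / (m s * m s) / (1 + (e s / m s)\<^sup>2))"
        by (intro continuous_intros) auto
    qed
    ultimately show "\<exists>L. L-lipschitz_on {0..l} g"
      unfolding g_def using lipschitz_on_Pair by blast
    fix s t assume st: "0 \<le> s \<and> s < t \<and> t \<le> l"
    have nst: "n s < n t"
    proof -
      have "cosh s * sinh A \<le> cosh t * sinh A"
        using st A cosh_real_nonneg_le_iff[of s t] by (intro mult_right_mono) auto
      moreover have "w * sinh s * cosh A < w * sinh t * cosh A" using w0 st by simp
      ultimately show ?thesis by (simp add: n_def)
    qed
    have one: "1 < cosh (t - s)" using cosh_real_strict_mono[of 0 "t - s"] st by simp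
    have "model_ll K (fst (g s), snd (g s)) (fst (g t), snd (g t))"
    proof (rule de_sitter_ll[OF K])
      show "fst (g s) < fst (g t)" using nst by (simp add: g_def)
      show "\<bar>snd (g t) - snd (g s)\<bar> \<le> pi"
        using arctan_lbound[of "e s / m s"] arctan_ubound[of "e s / m s"]
          arctan_lbound[of "e t / m t"] arctan_ubound[of "e t / m t"] by (simp add: g_def abs_if)
    qed (use P[of s t] one st in simp)
    then show ll: "model_ll K (g s) (g t)" by simp
    show "model_tau K (g s) (g t) = ennreal (1 / sqrt K * (t - s))"
      unfolding model_tau_def using model_ll_imp_le[OF ll] K P[of s t] st arcosh_cosh_real[of "t - s"] by simp
  qed (rule l)
  then show ?thesis by blast
qed

lemma lipschitz_on_axis: "\<exists>L. L-lipschitz_on {0..l} (\<lambda>s. (s, 0::real))" for l :: real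
  using lipschitz_on_Pair[OF lipschitz_on_id lipschitz_on_constant] by blast

lemma de_sitter_axis:
  assumes "0 < K" "0 < l"
  shows "model_segment K (1 / sqrt K) (0, 0) (l, 0) (\<lambda>s. (s, 0)) l"
  unfolding model_segment_def
proof (intro conjI allI impI)
  fix s t assume st: "0 \<le> s \<and> s < t \<and> t \<le> l"
  then show ll: "model_ll K (s, 0) (t, 0)" using assms by (simp add: model_ll_def)
  show "model_tau K (s, 0) (t, 0) = ennreal (1 / sqrt K * (t - s))"
    using model_ll_imp_le[OF ll] assms st arcosh_cosh_real[of "t - s"]
    by (simp add: model_tau_def cosh_diff mult.commute)
qed (use assms lipschitz_on_axis in auto)

lemma de_sitter_triangle:
  assumes K: "0 < K" and "0 < a" "0 < b" "a + b < c" "0 < u" "u < a"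
  shows "strict_model_triangle K (1 / sqrt K * a) (1 / sqrt K * b) (1 / sqrt K * c) (1 / sqrt K * u)"
proof -
  \<comment> \<open>With z = (T, \<theta>), length c from the origin means cosh T cos \<theta> =
    cosh c, and length b from (a, 0) then forces sinh T = n. The inequality a + b < c enters as sinh
    c < n.\<close>
  define n where "n = (cosh a * cosh c - cosh b) / sinh a"
  have sa: "0 < sinh a" using assms by simp
  have n: "n * sinh a = cosh a * cosh c - cosh b" using sa by (simp add: n_def)
  have "cosh b < cosh (c - a)" using assms by (intro cosh_real_strict_mono) auto
  then have "sinh a * sinh c < n * sinh a" unfolding n cosh_diff by (simp add: mult.commute)
  then have nc: "sinh c < n" using sa by (simp add: mult.commute[of n])
  define T where "T = arsinh n"
  have T: "sinh T = n" by (simp add: T_def)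
  have cT: "c < T" using nc T sinh_real_less_iff[of c T] by simp
  then have chT: "cosh c < cosh T" using assms by (intro cosh_real_strict_mono) auto
  define \<theta> where "\<theta> = arccos (cosh c / cosh T)"
  have r: "0 < cosh c / cosh T" "cosh c / cosh T < 1" using chT by auto
  have cos: "cosh T * cos \<theta> = cosh c" unfolding \<theta>_def using r by (subst cos_arccos) (linarith | simp)+
  have "0 \<le> \<theta>" "\<theta> \<le> pi" unfolding \<theta>_def using arccos_bounded[of "cosh c / cosh T"] r by auto
  moreover have "\<theta> < pi / 2" unfolding \<theta>_def using arccos_less_arccos[of 0 "cosh c / cosh T"] r by auto
  ultimately have th: "\<bar>\<theta>\<bar> < pi / 2" by simp
  have sc: "0 < sinh c" using assms by simp
  obtain h where 3: "model_segment K (1 / sqrt K) (0, 0) (T, \<theta>) h c"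
    using de_sitter_segment[OF K, of 0 c \<theta> T] th cos T nc sc assms by auto
  have 1: "model_segment K (1 / sqrt K) (0, 0) (a, 0) (\<lambda>s. (s, 0)) a"
    using de_sitter_axis[OF K] assms by simp
  \<comment> \<open>Needed for the direction of the side from (a, 0) to z: it gives the hypothesis
    \<open>fut\<close> of \<open>de_sitter_segment\<close>.\<close>
  have c_ab: "cosh a * cosh b < cosh c"
  proof -
    have "cosh (a + b) < cosh c" using assms by (intro cosh_real_strict_mono) auto
    moreover have "0 < sinh a * sinh b" using assms by simp
    ultimately show ?thesis unfolding cosh_add by linarith
  qed
  have hA: "(cosh a)\<^sup>2 = (sinh a)\<^sup>2 + 1" by (simp add: cosh_square_eq)
  have "\<exists>g. model_segment K (1 / sqrt K) (a, 0) (T, \<theta>) g b"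
  proof (rule de_sitter_segment[OF K _ _ th])
    show "cosh a * cosh T * cos \<theta> - sinh a * sinh T = cosh b"
      using cos T n by (simp add: mult.assoc mult.commute)
    have "sinh a * (n * cosh a - sinh a * cosh c) = cosh c - cosh a * cosh b"
      using n hA by algebra
    then have "0 < n * cosh a - sinh a * cosh c"
      using c_ab sa by (metis diff_gt_0_iff_gt zero_less_mult_pos)
    then show "sinh a * cosh T * cos \<theta> < sinh T * cosh a"
      using cos T by (simp add: mult.assoc)
  qed (use assms in auto)
  then obtain g where 2: "model_segment K (1 / sqrt K) (a, 0) (T, \<theta>) g b" ..
  have "model_tau K (u, 0) (T, \<theta>) < ennreal (1 / sqrt K * (c - u))"
  proof (cases "model_le K (u, 0) (T, \<theta>)")
    case True
    let ?Q = "cosh u * cosh T * cos \<theta> - sinh u * sinh T"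
    have Q1: "1 \<le> ?Q" using de_sitter_le_product[OF K True] by simp
    have "sinh u * sinh c < sinh u * sinh T" using nc T assms by simp
    then have "?Q < cosh (c - u)" unfolding cosh_diff mult.assoc cos by (simp add: mult.commute)
    then have "arcosh ?Q < arcosh (cosh (c - u))" using Q1 by (intro arcosh_real_strict_mono)
    then have "1 / sqrt K * arcosh ?Q < 1 / sqrt K * (c - u)"
      using K assms by (simp add: arcosh_cosh_real divide_strict_right_mono)
    then show ?thesis
      using True K assms Q1 by (auto simp: model_tau_def intro!: ennreal_lessI)
  qed (use K assms in \<open>auto simp: model_tau_def\<close>)
  then show ?thesis using strict_model_triangleI[OF _ 1 2 3, of u] K assms by simp
qed

subsection \<open>Anti-de Sitter plane\<close>

lemma anti_de_sitter_ll:
  assumes "K < 0" "t1 \<le> t2" "t2 - t1 \<le> pi"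
    and "cosh r1 * cosh r2 * cos (t2 - t1) - sinh r1 * sinh r2 < 1"
  shows "model_ll K (t1, r1) (t2, r2)"
proof -
  have "cosh r2 * cosh r1 * cos (t2 - t1) < cosh r2 * cosh r1 * cos (gd r2 - gd r1)"
    unfolding cos_gd_diff using assms(4) by (simp add: mult.commute)
  then have "cos (t2 - t1) < cos \<bar>gd r2 - gd r1\<bar>" by simp
  moreover have "\<bar>gd r2 - gd r1\<bar> \<le> pi"
    using gd_bounds[of r1] gd_bounds[of r2] by linarith
  ultimately have "\<bar>gd r2 - gd r1\<bar> < t2 - t1"
    using cos_mono_less_eq[of "t2 - t1" "\<bar>gd r2 - gd r1\<bar>"] assms(2,3) by auto
  then show ?thesis using assms(1) by (simp add: model_ll_def)
qed

lemma anti_de_sitter_le_product: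
  assumes "K < 0" "model_le K (t1, r1) (t2, r2)" "t2 - t1 \<le> pi"
  shows "cosh r1 * cosh r2 * cos (t2 - t1) - sinh r1 * sinh r2 \<le> 1"
proof -
  have le: "\<bar>gd r2 - gd r1\<bar> \<le> t2 - t1" using assms by (simp add: model_le_def)
  have "cos (t2 - t1) \<le> cos (gd r2 - gd r1)"
    using cos_monotone_0_pi_le[OF _ le assms(3)] by auto
  then have "cosh r2 * cosh r1 * cos (t2 - t1) \<le> cosh r2 * cosh r1 * cos (gd r2 - gd r1)"
    by (intro mult_left_mono) auto
  then show ?thesis unfolding cos_gd_diff by (simp add: mult.commute)
qed

text \<open>By \<open>cos_gd_add\<close>, the lower bound -1 on the product becomes the bound pi -
  |gd r1 + gd r2| on the time difference that separates the arccos case of \<open>model_tau\<close>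
  from the value infinity.\<close>

lemma anti_de_sitter_tau:
  assumes "K < 0" "model_le K (t1, r1) (t2, r2)" "t2 - t1 \<le> pi"
    and "- 1 \<le> cosh r1 * cosh r2 * cos (t2 - t1) - sinh r1 * sinh r2"
  shows "model_tau K (t1, r1) (t2, r2) =
    ennreal (1 / sqrt (- K) * arccos (cosh r1 * cosh r2 * cos (t2 - t1) - sinh r1 * sinh r2))"
proof -
  have "cosh r1 * cosh r2 * - cos (gd r1 + gd r2) = - (cosh r1 * cosh r2 * cos (gd r1 + gd r2))" by simp
  also have "\<dots> = - (1 - sinh r1 * sinh r2)" unfolding cos_gd_add ..
  finally have "cosh r1 * cosh r2 * - cos (gd r1 + gd r2) \<le> cosh r1 * cosh r2 * cos (t2 - t1)"
    using assms(4) by simp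
  then have "- cos (gd r1 + gd r2) \<le> cos (t2 - t1)"
    by (subst (asm) mult_le_cancel_left_pos) auto
  then have "cos (pi - \<bar>gd r1 + gd r2\<bar>) \<le> cos (t2 - t1)" by simp
  moreover have "\<bar>gd r1 + gd r2\<bar> \<le> pi" using gd_bounds[of r1] gd_bounds[of r2] by linarith
  moreover have "0 \<le> t2 - t1" using assms(1,2) by (simp add: model_le_def)
  ultimately have "t2 - t1 \<le> pi - \<bar>gd r1 + gd r2\<bar>"
    using cos_mono_le_eq[of "pi - \<bar>gd r1 + gd r2\<bar>" "t2 - t1"] assms(3) by auto
  then show ?thesis using assms(1,2) by (simp add: model_tau_def)
qed

text \<open>The geodesic is cos s P + sin s Q with P on the axis; in the ambient coordinates (cosh
  \<rho> cos t, cosh \<rho> sin t, sinh \<rho>), up to the time shift t0, it is (cos s, v sin s, w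
  sin s) with v^2 - w^2 = 1. The bound l < pi / 2 keeps cos s positive, hence the curve in the range
  of arctan.\<close>

lemma anti_de_sitter_segment:
  assumes K: "K < 0" and l: "0 < l" "l < pi / 2" and T: "0 < T" "T < pi / 2"
    and prod: "cosh \<rho> * cos T = cos l"
  shows "\<exists>g. model_segment K (1 / sqrt (- K)) (t0, 0) (t0 + T, \<rho>) g l"
proof -
  define v where "v = cosh \<rho> * sin T / sin l"
  define w where "w = sinh \<rho> / sin l"
  have sl: "0 < sin l" using l by (intro sin_gt_zero) auto
  have v0: "0 < v" using T sl sin_gt_zero[of T] by (simp add: v_def)
  have "(cosh \<rho> * sin T)\<^sup>2 - (sinh \<rho>)\<^sup>2 = (sin l)\<^sup>2"
  proof -
    have "(cosh \<rho>)\<^sup>2 = (sinh \<rho>)\<^sup>2 + 1" "(cos T)\<^sup>2 + (sin T)\<^sup>2 = 1" "(cos l)\<^sup>2 + (sin l)\<^sup>2 = 1"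
      by (simp_all add: cosh_square_eq)
    then show ?thesis using prod by algebra
  qed
  then have "(sin l)\<^sup>2 * (v\<^sup>2 - w\<^sup>2) = (sin l)\<^sup>2 * 1"
    using sl by (simp add: w_def v_def power_divide field_simps)
  then have vw: "v\<^sup>2 - w\<^sup>2 = 1" using sl mult_cancel_left[of "(sin l)\<^sup>2"] by simp
  have cs: "0 < cos s" if "0 \<le> s" "s \<le> l" for s using that l by (intro cos_gt_zero_pi) auto
  define g where "g s = (t0 + arctan (v * sin s / cos s), arsinh (w * sin s))" for s
  have emb: "(cos s)\<^sup>2 + (v * sin s)\<^sup>2 = (w * sin s)\<^sup>2 + 1" for s
  proof -
    have "(cos s)\<^sup>2 + (sin s)\<^sup>2 = 1" by simp
    then show ?thesis using vw by algebra
  qed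
  have P: "cosh (snd (g s)) * cosh (snd (g t)) * cos (fst (g t) - fst (g s)) - sinh (snd (g s)) * sinh (snd (g t))
      = cos (t - s)" if st: "0 \<le> s" "s \<le> l" "0 \<le> t" "t \<le> l" for s t
  proof -
    note cc = cosh_cos_sin_of_embedding[OF emb[of s] cs[OF st(1,2)]]
      cosh_cos_sin_of_embedding[OF emb[of t] cs[OF st(3,4)]]
    have "cosh (snd (g s)) * cosh (snd (g t)) * cos (fst (g t) - fst (g s)) =
        (cosh (arsinh (w * sin s)) * cos (arctan (v * sin s / cos s))) *
        (cosh (arsinh (w * sin t)) * cos (arctan (v * sin t / cos t)))
      + (cosh (arsinh (w * sin s)) * sin (arctan (v * sin s / cos s))) *
        (cosh (arsinh (w * sin t)) * sin (arctan (v * sin t / cos t)))"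
      by (simp add: g_def cos_diff algebra_simps)
    also have "\<dots> = cos s * cos t + v\<^sup>2 * (sin s * sin t)"
      unfolding cc by (simp add: power2_eq_square algebra_simps)
    also have "v\<^sup>2 = 1 + w\<^sup>2" using vw by simp
    finally show ?thesis by (simp add: g_def cos_diff power2_eq_square algebra_simps)
  qed
  have "model_segment K (1 / sqrt (- K)) (t0, 0) (t0 + T, \<rho>) g l"
    unfolding model_segment_def
  proof (intro conjI allI impI)
    show "g 0 = (t0, 0)" by (simp add: g_def)
    have "v * sin l / cos l = tan T" using sl by (simp add: v_def tan_def prod[symmetric])
    then have "arctan (v * sin l / cos l) = T" using arctan_tan[of T] T by simp
    moreover have "w * sin l = sinh \<rho>" using sl by (simp add: w_def)
    ultimately show "g l = (t0 + T, \<rho>)" by (simp add: g_def arsinh_sinh_real)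
    have "\<exists>L. L-lipschitz_on {0..l} (\<lambda>s. arsinh (w * sin s))"
    proof (rule C1_imp_lipschitz_on[where f' = "\<lambda>s. 1 / sqrt ((w * sin s)\<^sup>2 + 1) * (w * cos s)"])
      fix s
      have "((\<lambda>s. w * sin s) has_real_derivative w * cos s) (at s within {0..l})"
        by (auto intro!: derivative_eq_intros)
      then show "((\<lambda>s. arsinh (w * sin s)) has_real_derivative
          1 / sqrt ((w * sin s)\<^sup>2 + 1) * (w * cos s)) (at s within {0..l})"
        by (rule DERIV_chain2[OF arsinh_real_has_field_derivative])
    qed (auto intro!: continuous_intros simp: add_nonneg_pos less_imp_neq[THEN not_sym])
    moreover have "\<exists>L. L-lipschitz_on {0..l} (\<lambda>s. t0 + arctan (v * sin s / cos s))"
    proof (rule C1_imp_lipschitz_on[where f' = "\<lambda>s. (v * cos s * cos s + v * sin s * sin s)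
            / (cos s * cos s) / (1 + (v * sin s / cos s)\<^sup>2)"])
      fix s assume s: "s \<in> {0..l}"
      then have "cos s \<noteq> 0" using cs[of s] by simp
      then show "((\<lambda>s. t0 + arctan (v * sin s / cos s)) has_field_derivative
          (v * cos s * cos s + v * sin s * sin s) / (cos s * cos s) / (1 + (v * sin s / cos s)\<^sup>2))
          (at s within {0..l})"
        by (auto intro!: derivative_eq_intros simp: field_simps)
    next
      have "cos s \<noteq> 0" if "s \<in> {0..l}" for s using cs[of s] that by simp
      moreover have "1 + (v * sin s / cos s)\<^sup>2 \<noteq> 0" for s
        by (metis add_pos_nonneg less_irrefl zero_le_power2 zero_less_one)
      ultimately show "continuous_on {0..l} (\<lambda>s. (v * cos s * cos s + v * sin s * sin s)
            / (cos s * cos s) / (1 + (v * sin s / cos s)\<^sup>2))"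
        by (intro continuous_intros) auto
    qed
    ultimately show "\<exists>L. L-lipschitz_on {0..l} g"
      unfolding g_def using lipschitz_on_Pair by blast
    fix s t assume st: "0 \<le> s \<and> s < t \<and> t \<le> l"
    have "tan s < tan t" using st l by (intro tan_monotone) auto
    then have "v * sin s / cos s < v * sin t / cos t" using v0 by (simp add: tan_def flip: times_divide_eq_right)
    then have tt: "fst (g s) < fst (g t)" by (simp add: g_def arctan_less_iff)
    have tp: "fst (g t) - fst (g s) \<le> pi"
      using arctan_lbound[of "v * sin s / cos s"] arctan_ubound[of "v * sin t / cos t"]
      unfolding g_def fst_conv by linarith
    have one: "cos (t - s) < 1" using cos_monotone_0_pi[of 0 "t - s"] st l by simp
    have "model_ll K (fst (g s), snd (g s)) (fst (g t), snd (g t))"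
      by (rule anti_de_sitter_ll[OF K _ tp]) (use tt P[of s t] one st in auto)
    then show ll: "model_ll K (g s) (g t)" by simp
    have "model_le K (fst (g s), snd (g s)) (fst (g t), snd (g t))" using model_ll_imp_le[OF ll] by simp
    from anti_de_sitter_tau[OF K this tp] P[of s t] st l arccos_cos[of "t - s"]
    show "model_tau K (g s) (g t) = ennreal (1 / sqrt (- K) * (t - s))" by simp
  qed (rule l)
  then show ?thesis by blast
qed

lemma anti_de_sitter_axis:
  assumes K: "K < 0" and l: "0 < l" "l \<le> pi"
  shows "model_segment K (1 / sqrt (- K)) (0, 0) (l, 0) (\<lambda>s. (s, 0)) l"
  unfolding model_segment_def
proof (intro conjI allI impI)
  fix s t assume st: "0 \<le> s \<and> s < t \<and> t \<le> l"
  then show ll: "model_ll K (s, 0) (t, 0)" using K by (simp add: model_ll_def)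
  show "model_tau K (s, 0) (t, 0) = ennreal (1 / sqrt (- K) * (t - s))"
    using anti_de_sitter_tau[OF K model_ll_imp_le[OF ll]] st l arccos_cos[of "t - s"] by simp
qed (use l lipschitz_on_axis in auto)

lemma anti_de_sitter_triangle:
  assumes K: "K < 0" and "0 < a" "0 < b" "a + b < c" "0 < u" "u < a" and c: "c < pi / 2"
  shows "strict_model_triangle K (1 / sqrt (- K) * a) (1 / sqrt (- K) * b) (1 / sqrt (- K) * c) (1 / sqrt (- K) * u)"
proof -
  \<comment> \<open>(m, n) are to be the ambient coordinates (cosh \<rho> cos T, cosh \<rho> sin T)
    of z. The product of z with the axis point (s, 0) is then m cos s + n sin s, which has to be cos
    c at s = 0 and cos b at s = a.\<close>
  define m where "m = cos c"
  define n where "n = (cos b - cos a * cos c) / sin a"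
  have sa: "0 < sin a" using assms by (intro sin_gt_zero) auto
  have n: "n * sin a = cos b - cos a * cos c" using sa by (simp add: n_def)
  have m0: "0 < m" unfolding m_def using assms by (intro cos_gt_zero_pi) auto
  have "cos (c - a) < cos b" using assms by (intro cos_monotone_0_pi) auto
  then have "sin a * sin c < sin a * n" unfolding mult.commute[of "sin a" n] n cos_diff by (simp add: mult.commute)
  then have nc: "sin c < n" using sa by simp
  have sc: "0 < sin c" using assms by (intro sin_gt_zero) auto
  have "(sin c)\<^sup>2 < n\<^sup>2" using nc sc by (intro power_strict_mono) auto
  moreover have "m\<^sup>2 + (sin c)\<^sup>2 = 1" by (simp add: m_def)
  ultimately have R2: "1 < m\<^sup>2 + n\<^sup>2" by linarith
  define \<rho> where "\<rho> = arsinh (sqrt (m\<^sup>2 + n\<^sup>2 - 1))"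
  have "(sqrt (m\<^sup>2 + n\<^sup>2 - 1))\<^sup>2 = m\<^sup>2 + n\<^sup>2 - 1" using R2 by simp
  then have emb: "m\<^sup>2 + n\<^sup>2 = (sqrt (m\<^sup>2 + n\<^sup>2 - 1))\<^sup>2 + 1" by simp
  define T where "T = arctan (n / m)"
  have cosT: "cosh \<rho> * cos T = m" and sinT: "cosh \<rho> * sin T = n"
    using cosh_cos_sin_of_embedding[OF emb m0] unfolding \<rho>_def T_def by auto
  have T: "0 < T" "T < pi / 2" unfolding T_def using nc sc m0 arctan_ubound by auto
  have prod: "cosh \<rho> * cos (T - s) = m * cos s + n * sin s" for s
    by (simp add: cos_diff cosT[symmetric] sinT[symmetric] algebra_simps)
  obtain h where 3: "model_segment K (1 / sqrt (- K)) (0, 0) (T, \<rho>) h c"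
    using anti_de_sitter_segment[OF K _ c T, of \<rho> 0] cosT assms by (auto simp: m_def)
  have 1: "model_segment K (1 / sqrt (- K)) (0, 0) (a, 0) (\<lambda>s. (s, 0)) a"
    using anti_de_sitter_axis[OF K] assms by simp
  have "\<exists>g. model_segment K (1 / sqrt (- K)) (a, 0) (a + (T - a), \<rho>) g b"
  proof (rule anti_de_sitter_segment[OF K])
    have sc1: "(cos a)\<^sup>2 + (sin a)\<^sup>2 = 1" by simp
    show "cosh \<rho> * cos (T - a) = cos b" unfolding prod m_def n by simp
    \<comment> \<open>Shows that z comes later than (a, 0): the sign of sin (T - a) is that of cos a
      cos b - cos c.\<close>
    have "cos c < cos (a + b)" using assms by (intro cos_monotone_0_pi) auto
    moreover have "0 < sin b" using assms by (intro sin_gt_zero) auto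
    ultimately have "cos c < cos a * cos b" unfolding cos_add using sa
      by (smt (verit) mult_pos_pos)
    moreover have "cosh \<rho> * sin (T - a) * sin a = cos a * cos b - cos c"
    proof -
      have "cosh \<rho> * sin (T - a) * sin a = (n * sin a) * cos a - m * (sin a)\<^sup>2"
        by (simp add: sin_diff cosT[symmetric] sinT[symmetric] power2_eq_square algebra_simps)
      then show ?thesis unfolding n m_def using sc1 by algebra
    qed
    ultimately have "0 < (cosh \<rho> * sin a) * sin (T - a)" by (simp add: algebra_simps)
    then have "0 < sin (T - a)" by (rule zero_less_mult_pos) (use sa in simp)
    moreover have "sin (T - a) \<le> 0" if "T - a \<le> 0"
      using that sin_ge_zero[of "a - T"] T assms sin_minus[of "a - T"] by simp
    ultimately show "0 < T - a" by fastforce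
  qed (use assms T in auto)
  then obtain g where 2: "model_segment K (1 / sqrt (- K)) (a, 0) (T, \<rho>) g b" by auto
  have Tu: "T - u \<le> pi" using T assms by linarith
  have "model_tau K (u, 0) (T, \<rho>) < ennreal (1 / sqrt (- K) * (c - u))"
  proof (cases "model_le K (u, 0) (T, \<rho>)")
    case True
    let ?Q = "cosh \<rho> * cos (T - u)"
    have Q1: "?Q \<le> 1" using anti_de_sitter_le_product[OF K True Tu] by simp
    have su: "0 < sin u" using assms by (intro sin_gt_zero) auto
    then have Q2: "cos (c - u) < ?Q" using nc by (simp add: prod cos_diff[of c u] m_def)
    have Q3: "-1 \<le> ?Q" using Q2 cos_ge_minus_one[of "c - u"] by linarith
    have "arccos ?Q < arccos (cos (c - u))" using Q1 Q2 by (intro arccos_less_arccos) auto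
    then have "arccos ?Q < c - u" using arccos_cos[of "c - u"] assms by simp
    moreover have "0 \<le> arccos ?Q" using arccos_lbound Q1 Q3 by blast
    moreover have "model_tau K (u, 0) (T, \<rho>) = ennreal (1 / sqrt (- K) * arccos ?Q)"
      using anti_de_sitter_tau[OF K True Tu] Q3 by simp
    ultimately show ?thesis
      using K assms by (auto intro!: ennreal_lessI divide_strict_right_mono)
  qed (use K assms in \<open>auto simp: model_tau_def\<close>)
  then show ?thesis using strict_model_triangleI[OF _ 1 2 3, of u] K assms by simp
qed

text \<open>For K < 0 the bound pi / (2 sqrt (-K)) is what \<open>anti_de_sitter_triangle\<close>
  asks for, and it lies below the size bound pi / sqrt (-K). For the other signs the value 1 is an
  arbitrary choice.\<close>

lemma small_strict_model_triangle:
  obtains \<delta> where "0 < \<delta>"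
    "\<And>a b c u. \<lbrakk>0 < a; 0 < b; a + b < c; c < \<delta>; 0 < u; u < a\<rbrakk> \<Longrightarrow>
       strict_model_triangle K a b c u \<and> timelike_size_bounds K a b c"
proof -
  consider "K < 0" | "K = 0" | "0 < K" by linarith
  then show thesis
  proof cases
    case 1
    define k where "k = sqrt (- K)"
    have k: "0 < k" using 1 by (simp add: k_def)
    show thesis
    proof (rule that[of "pi / 2 / k"])
      fix a b c u :: real assume *: "0 < a" "0 < b" "a + b < c" "c < pi / 2 / k" "0 < u" "u < a"
      have "k * c < pi / 2" using * k by (simp add: field_simps)
      moreover have "k * a + k * b < k * c" using * k by (metis distrib_left mult_less_cancel_left_pos)
      ultimately have "strict_model_triangle K (1 / k * (k * a)) (1 / k * (k * b)) (1 / k * (k * c)) (1 / k * (k * u))"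
        unfolding k_def using * k 1 by (intro anti_de_sitter_triangle) (auto simp: k_def)
      moreover have "pi / 2 / k < pi / k" using divide_strict_right_mono[OF _ k, of "pi / 2" pi] by simp
      ultimately show "strict_model_triangle K a b c u \<and> timelike_size_bounds K a b c"
        using * k 1 by (auto simp: timelike_size_bounds_def k_def)
    qed (use k in simp)
  next
    case 2
    show thesis
      by (rule that[of 1]) (use 2 minkowski_triangle in \<open>auto simp: timelike_size_bounds_def\<close>)
  next
    case 3
    define k where "k = sqrt K"
    have k: "0 < k" using 3 by (simp add: k_def)
    show thesis
    proof (rule that[of 1])
      fix a b c u :: real assume *: "0 < a" "0 < b" "a + b < c" "c < 1" "0 < u" "u < a"
      have "k * a + k * b < k * c" using * k by (metis distrib_left mult_less_cancel_left_pos)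
      then have "strict_model_triangle K (1 / k * (k * a)) (1 / k * (k * b)) (1 / k * (k * c)) (1 / k * (k * u))"
        unfolding k_def using * k 3 by (intro de_sitter_triangle) (auto simp: k_def)
      then show "strict_model_triangle K a b c u \<and> timelike_size_bounds K a b c"
        using * k 3 by (auto simp: timelike_size_bounds_def)
    qed simp
  qed
qed

subsection \<open>Lorentzian pre-length spaces\<close>

locale lorentzian_pre_length =
  fixes ll le :: "'a::metric_space \<Rightarrow> 'a \<Rightarrow> bool" and tau :: "'a \<Rightarrow> 'a \<Rightarrow> ennreal"
  assumes lpls: "lorentzian_pre_length_space ll le tau"
begin

lemma reflp_le: "reflp le"
  and le_refl: "le x x"
  and le_trans: "le x y \<Longrightarrow> le y z \<Longrightarrow> le x z"
  and ll_imp_le: "ll x y \<Longrightarrow> le x y"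
  and tau_pos_iff: "0 < tau x y \<longleftrightarrow> ll x y"
  and reverse_triangle: "le x y \<Longrightarrow> le y z \<Longrightarrow> tau x y + tau y z \<le> tau x z"
  and open_tau_greater: "open {p. c < case_prod tau p}"
  using lpls unfolding lorentzian_pre_length_space_def causal_space_def
  by (auto dest: reflpD transpD)

text \<open>Push-up: the reverse triangle inequality passes positivity of \<open>tau\<close>
  on.\<close>

lemma ll_le_trans:
  assumes "ll x y" "le y z"
  shows "ll x z"
proof -
  have "0 < tau x y + tau y z" using assms(1) tau_pos_iff by (simp add: add_pos_nonneg)
  also have "\<dots> \<le> tau x z" using assms ll_imp_le reverse_triangle by blast
  finally show ?thesis by (simp add: tau_pos_iff)
qed

lemma le_ll_trans:
  assumes "le x y" "ll y z"
  shows "ll x z"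
proof -
  have "0 < tau x y + tau y z" using assms(2) tau_pos_iff by (simp add: add_nonneg_pos)
  also have "\<dots> \<le> tau x z" using assms ll_imp_le reverse_triangle by blast
  finally show ?thesis by (simp add: tau_pos_iff)
qed

text \<open>A finite value v with v + v \<le> v is zero. Finiteness thus excludes timelike loops, on
  which all arguments by contradiction with \<open>ll x x\<close> rely.\<close>

lemma tau_self_eq_0:
  assumes "tau x x < \<infinity>"
  shows "tau x x = 0"
  using reverse_triangle[OF le_refl le_refl, of x] assms
  by (cases "tau x x") (auto simp flip: ennreal_plus simp: top_unique)

lemma not_ll_self: "tau x x < \<infinity> \<Longrightarrow> \<not> ll x x"
  using tau_self_eq_0[of x] tau_pos_iff[of x x] by auto

lemma timelike_imp_causal: "fd_timelike_curve ll g a b \<Longrightarrow> fd_causal_curve le g a b"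
  unfolding fd_timelike_curve_def fd_causal_curve_def using ll_imp_le by blast

lemma causal_curve_le:
  assumes "fd_causal_curve le g a b" "a \<le> s" "s \<le> u" "u \<le> b"
  shows "le (g s) (g u)"
  using assms le_refl unfolding fd_causal_curve_def by (cases "s = u") auto

lemma timelike_curve_restrict:
  assumes "fd_timelike_curve ll g a b" "a \<le> s" "s < u" "u \<le> b" "tau (g s) (g s) < \<infinity>"
  shows "fd_timelike_curve ll g s u"
proof -
  obtain L where "L-lipschitz_on {a..b} g"
    using fd_causal_curve_lipschitz[OF timelike_imp_causal[OF assms(1)]] .
  then have "loc_lipschitz_on {s..u} g"
    using assms by (intro lipschitz_imp_loc_lipschitz_on[OF lipschitz_on_subset]) auto
  moreover have "ll (g s) (g u)" using assms unfolding fd_timelike_curve_def by auto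
  then have "g s \<noteq> g u" using not_ll_self[OF assms(5)] by auto
  then have "\<exists>x\<in>{s..u}. \<exists>y\<in>{s..u}. g x \<noteq> g y" using assms by (intro bexI[of _ s] bexI[of _ u]) auto
  ultimately show ?thesis using assms unfolding fd_timelike_curve_def by auto
qed

text \<open>F s is \<open>tau (g a) (g s)\<close>. Maximality bounds the total by the sum over a, s,
  u, b, and the reverse triangle inequality bounds such sums by the total, so equality holds
  throughout.\<close>

lemma maximal_potential:
  assumes g: "fd_causal_curve le g a b" and max: "tau_length tau g a b = tau (g a) (g b)"
    and fin: "tau (g a) (g b) < \<infinity>"
  obtains F where
    "\<And>s u. a \<le> s \<Longrightarrow> s \<le> u \<Longrightarrow> u \<le> b \<Longrightarrow> F s \<le> F u \<and> tau (g s) (g u) = ennreal (F u - F s)"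
proof -
  note le = causal_curve_le[OF g]
  have ab: "a < b" using g by (simp add: fd_causal_curve_def)
  have sub: "tau (g s) (g u) \<le> tau (g a) (g b)" if "a \<le> s" "s \<le> u" "u \<le> b" for s u
  proof -
    have "tau (g s) (g u) \<le> tau (g a) (g s) + tau (g s) (g u)" by simp
    also have "\<dots> \<le> tau (g a) (g u)" using that by (intro reverse_triangle le) auto
    also have "\<dots> \<le> tau (g a) (g u) + tau (g u) (g b)" by simp
    also have "\<dots> \<le> tau (g a) (g b)" using that by (intro reverse_triangle le) auto
    finally show ?thesis .
  qed
  define T where "T s u = enn2real (tau (g s) (g u))" for s u
  have T: "tau (g s) (g u) = ennreal (T s u)" "0 \<le> T s u" if "a \<le> s" "s \<le> u" "u \<le> b" for s u
    using sub[OF that] fin by (auto simp: T_def)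
  have "T a s \<le> T a u \<and> tau (g s) (g u) = ennreal (T a u - T a s)" if su: "a \<le> s" "s \<le> u" "u \<le> b" for s u
  proof (cases "s = u")
    case True
    have "tau (g s) (g s) < \<infinity>" using sub[of s s] su fin by (metis True order_le_less_trans order_refl)
    then show ?thesis using tau_self_eq_0 True by simp
  next
    case False
    have "ennreal (T a b) \<le> ennreal (T a s) + ennreal (T s u) + ennreal (T u b)"
      using tau_length_le_refined[of a s u b tau g] max False su T[of a b] T[of a s] T[of s u] T[of u b] ab by simp
    then have 1: "T a b \<le> T a s + T s u + T u b"
      using su T[of a b] T[of a s] T[of s u] T[of u b] ab by (simp flip: ennreal_plus)
    have "tau (g a) (g s) + tau (g s) (g u) \<le> tau (g a) (g u)"
      using su by (intro reverse_triangle le) auto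
    then have 2: "T a s + T s u \<le> T a u"
      using su T[of a u] T[of a s] T[of s u] by (simp flip: ennreal_plus)
    have "tau (g a) (g u) + tau (g u) (g b) \<le> tau (g a) (g b)"
      using su by (intro reverse_triangle le) auto
    then have 3: "T a u + T u b \<le> T a b"
      using su T[of a u] T[of u b] T[of a b] ab by (simp flip: ennreal_plus)
    have "T s u = T a u - T a s" using 1 2 3 by linarith
    then show ?thesis using T[of s u] su by simp
  qed
  then show thesis by (rule that)
qed

text \<open>The curve may leave any neighbourhood on which \<open>tau\<close> is finite. By
  bisection the interval nevertheless has a partition whose sum is finite, and this sum bounds the
  length, which by maximality is the separation of the end points.\<close>

lemma maximal_finite:
  assumes g: "fd_causal_curve le g a b" and max: "tau_length tau g a b = tau (g a) (g b)"
    and loc: "\<And>x. \<exists>U. neighbourhood U x \<and> (\<forall>p\<in>U. \<forall>q\<in>U. tau p q < \<infinity>)"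
  shows "tau (g a) (g b) < \<infinity>"
proof -
  have ab: "a < b" using g by (simp add: fd_causal_curve_def)
  have cont: "continuous_on {a..b} g" by (rule fd_causal_curve_continuous[OF g])
  let ?S = "\<lambda>ts. \<Sum>i<length ts - 1. tau (g (ts ! i)) (g (ts ! (i + 1)))"
  let ?P = "\<lambda>u v. a \<le> u \<longrightarrow> v \<le> b \<longrightarrow> (\<exists>ts \<in> partitions u v. ?S ts < \<infinity>)"
  have "?P a b"
  proof (rule Bolzano[where P = ?P, OF less_imp_le[OF ab]])
    fix u v w assume P: "?P u v" "?P v w" and uvw: "u \<le> v" "v \<le> w"
    show "?P u w"
    proof (intro impI)
      assume "a \<le> u" "w \<le> b"
      then obtain xs ys where xs: "xs \<in> partitions u v" "?S xs < \<infinity>"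
        and ys: "ys \<in> partitions v w" "?S ys < \<infinity>"
        using P uvw by force
      have x: "xs \<noteq> []" "sorted_wrt (<) xs" "hd xs = u" "last xs = v"
        and y: "ys \<noteq> []" "sorted_wrt (<) ys" "hd ys = v" "last ys = w"
        using xs ys by (auto simp: partitions_def)
      have "xs @ tl ys \<in> partitions u w"
      proof -
        obtain y' where y': "ys = v # y'" using y by (cases ys) auto
        have "p < q" if "p \<in> set xs" "q \<in> set y'" for p q
          using le_last_if_strict_sorted[OF x(2) that(1)] x(4) y(2) that(2) y' by auto
        then show ?thesis using x y y' by (auto simp: partitions_def sorted_wrt_append)
      qed
      moreover have "?S (xs @ tl ys) = ?S xs + ?S ys"
        using x y by (intro psum_append_tl[of xs ys "\<lambda>s t. tau (g s) (g t)"]) auto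
      then have "?S (xs @ tl ys) < \<infinity>" using xs(2) ys(2) by simp
      ultimately show "\<exists>ts \<in> partitions u w. ?S ts < \<infinity>" by blast
    qed
  next
    fix x assume x: "a \<le> x" "x \<le> b"
    obtain U where "neighbourhood U (g x)" and U: "\<forall>p\<in>U. \<forall>q\<in>U. tau p q < \<infinity>" using loc by blast
    then obtain W where W: "open W" "g x \<in> W" "W \<subseteq> U" unfolding neighbourhood_def by blast
    obtain A where A: "open A" "x \<in> A" "\<forall>y\<in>{a..b}. y \<in> A \<longrightarrow> g y \<in> W"
      using cont x W unfolding continuous_on_topological by (metis atLeastAtMost_iff)
    then obtain e where e: "e > 0" "\<And>y. dist y x < e \<Longrightarrow> y \<in> A" unfolding open_dist by blast
    have "?P u v" if uv: "u \<le> x" "x \<le> v" "v - u < e" for u v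
    proof (intro impI)
      assume "a \<le> u" "v \<le> b"
      then have "g u \<in> U" "g v \<in> U" using A(3) W(3) e(2)[of u] e(2)[of v] uv
        by (auto simp: dist_real_def)
      then have fin: "tau (g u) (g v) < \<infinity>" using U by blast
      show "\<exists>ts \<in> partitions u v. ?S ts < \<infinity>"
      proof (cases "u = v")
        case True
        then show ?thesis by (intro bexI[of _ "[u]"]) (auto simp: partitions_def)
      next
        case False
        then show ?thesis using uv fin by (intro bexI[of _ "[u, v]"]) (auto simp: partitions_def)
      qed
    qed
    then show "\<exists>d>0. \<forall>u v. u \<le> x \<and> x \<le> v \<and> v - u < d \<longrightarrow> ?P u v" using e(1) by blast
  qed
  then obtain ts where ts: "ts \<in> partitions a b" "?S ts < \<infinity>" by blast
  have "tau_length tau g a b \<le> ?S ts"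
    unfolding tau_length_def using ts by (intro Inf_lower) blast
  then show ?thesis using max ts(2) by (metis order_le_less_trans)
qed

text \<open>The potentials of the two pieces glue to a potential H. For points on different sides of
  the joint, the reverse triangle inequality through the joint gives one inequality; the other holds
  because a larger value would push the separation of the outer end points above the sum assumed for
  it.\<close>

lemma concat_maximal:
  fixes g1 g2 :: "real \<Rightarrow> 'a" and a1 b1 a2 b2 :: real
  assumes g1: "fd_causal_curve le g1 a1 b1" and g2: "fd_causal_curve le g2 a2 b2" and j: "g1 b1 = g2 a2"
    and m1: "tau_length tau g1 a1 b1 = tau (g1 a1) (g1 b1)"
    and m2: "tau_length tau g2 a2 b2 = tau (g2 a2) (g2 b2)"
    and add: "tau (g1 a1) (g2 b2) = tau (g1 a1) (g1 b1) + tau (g2 a2) (g2 b2)"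
    and fin: "tau (g1 a1) (g2 b2) < \<infinity>"
  obtains h where "fd_causal_curve le h a1 (b1 + (b2 - a2))"
    "tau_length tau h a1 (b1 + (b2 - a2)) = tau (g1 a1) (g2 b2)"
    "\<And>s. s \<le> b1 \<Longrightarrow> h s = g1 s" "\<And>s. b1 \<le> s \<Longrightarrow> h s = g2 (s - b1 + a2)"
proof -
  define h where "h = (\<lambda>s. if s \<le> b1 then g1 s else g2 (s - b1 + a2))"
  define e where "e = b1 + (b2 - a2)"
  have ab: "a1 < b1" "a2 < b2" using g1 g2 by (auto simp: fd_causal_curve_def)
  have h1: "h s = g1 s" if "s \<le> b1" for s using that by (simp add: h_def)
  have h2: "h s = g2 (s - b1 + a2)" if "b1 \<le> s" for s using that j by (auto simp: h_def)
  have be: "b1 < e" using ab by (simp add: e_def)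
  obtain L1 where L1: "L1-lipschitz_on {a1..b1} g1" by (rule fd_causal_curve_lipschitz[OF g1])
  obtain L2 where L2: "L2-lipschitz_on {a2..b2} g2" by (rule fd_causal_curve_lipschitz[OF g2])
  have "L2-lipschitz_on {b1..e} (\<lambda>s. g2 (s - b1 + a2))"
  proof (rule lipschitz_onI)
    fix s t assume "s \<in> {b1..e}" "t \<in> {b1..e}"
    then show "dist (g2 (s - b1 + a2)) (g2 (t - b1 + a2)) \<le> L2 * dist s t"
      using lipschitz_onD[OF L2, of "s - b1 + a2" "t - b1 + a2"] by (simp add: dist_real_def e_def)
  qed (rule lipschitz_on_nonneg[OF L2])
  then have "(max L1 L2)-lipschitz_on {a1..e} h"
    unfolding h_def using j by (intro lipschitz_on_concat_max[OF L1]) auto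
  then have lip: "loc_lipschitz_on {a1..e} h" by (rule lipschitz_imp_loc_lipschitz_on)
  have "\<exists>s\<in>{a1..e}. \<exists>t\<in>{a1..e}. h s \<noteq> h t"
  proof -
    obtain s t where "s \<in> {a1..b1}" "t \<in> {a1..b1}" "g1 s \<noteq> g1 t"
      using g1 unfolding fd_causal_curve_def by blast
    then show ?thesis using h1 be by (intro bexI[of _ s] bexI[of _ t]) auto
  qed
  moreover have lest: "le (h s) (h t)" if st: "a1 \<le> s" "s < t" "t \<le> e" for s t
  proof -
    consider "t \<le> b1" | "b1 \<le> s" | "s < b1" "b1 < t" by linarith
    then show ?thesis
    proof cases
      case 1
      then show ?thesis using st h1 causal_curve_le[OF g1, of s t] by simp
    next
      case 2
      then show ?thesis using st h2 causal_curve_le[OF g2, of "s - b1 + a2" "t - b1 + a2"] by (simp add: e_def)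
    next
      case 3
      then have "le (g1 s) (g1 b1)" "le (g2 a2) (g2 (t - b1 + a2))"
        using st causal_curve_le[OF g1, of s b1] causal_curve_le[OF g2, of a2 "t - b1 + a2"] by (auto simp: e_def)
      then show ?thesis using 3 st h1[of s] h2[of t] j le_trans by simp
    qed
  qed
  ultimately have causal: "fd_causal_curve le h a1 e"
    unfolding fd_causal_curve_def using ab be lip by auto
  have fin1: "tau (g1 a1) (g1 b1) < \<infinity>" and fin2: "tau (g2 a2) (g2 b2) < \<infinity>"
    using fin unfolding add by auto
  obtain F where F: "\<And>s u. a1 \<le> s \<Longrightarrow> s \<le> u \<Longrightarrow> u \<le> b1 \<Longrightarrow> F s \<le> F u \<and> tau (g1 s) (g1 u) = ennreal (F u - F s)"
    using maximal_potential[OF g1 m1 fin1] by blast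
  obtain G where G: "\<And>s u. a2 \<le> s \<Longrightarrow> s \<le> u \<Longrightarrow> u \<le> b2 \<Longrightarrow> G s \<le> G u \<and> tau (g2 s) (g2 u) = ennreal (G u - G s)"
    using maximal_potential[OF g2 m2 fin2] by blast
  define H where "H s = (if s \<le> b1 then F s else F b1 + (G (s - b1 + a2) - G a2))" for s
  have H1: "H s = F s" if "s \<le> b1" for s using that by (simp add: H_def)
  have H2: "H s = F b1 + (G (s - b1 + a2) - G a2)" if "b1 \<le> s" for s using that by (auto simp: H_def)
  have "H s \<le> H t \<and> tau (h s) (h t) = ennreal (H t - H s)" if st: "a1 \<le> s" "s < t" "t \<le> e" for s t
  proof -
    consider "t \<le> b1" | "b1 \<le> s" | "s < b1" "b1 < t" by linarith
    then show ?thesis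
    proof cases
      case 1
      then show ?thesis using st h1 H1 F[of s t] by simp
    next
      case 2
      then show ?thesis using st h2 H2 G[of "s - b1 + a2" "t - b1 + a2"] by (simp add: e_def)
    next
      case 3
      define t' where "t' = t - b1 + a2"
      have t': "a2 \<le> t'" "t' \<le> b2" using 3 st by (auto simp: t'_def e_def)
      have hs: "h s = g1 s" "h t = g2 t'" "H s = F s" "H t = F b1 + (G t' - G a2)"
        using 3 h1 h2 H1 H2 by (auto simp: t'_def)
      have Fs: "F a1 \<le> F s" "F s \<le> F b1" "tau (g1 a1) (g1 s) = ennreal (F s - F a1)"
          "tau (g1 s) (g1 b1) = ennreal (F b1 - F s)" "tau (g1 a1) (g1 b1) = ennreal (F b1 - F a1)"
        using F[of a1 s] F[of s b1] F[of a1 b1] 3 st by auto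
      have Gt: "G a2 \<le> G t'" "G t' \<le> G b2" "tau (g2 a2) (g2 t') = ennreal (G t' - G a2)"
          "tau (g2 t') (g2 b2) = ennreal (G b2 - G t')" "tau (g2 a2) (g2 b2) = ennreal (G b2 - G a2)"
        using G[of a2 t'] G[of t' b2] G[of a2 b2] t' ab by auto
      have les: "le (g1 a1) (g1 s)" "le (g1 s) (g1 b1)" "le (g1 b1) (g2 t')" "le (g2 t') (g2 b2)" "le (g1 s) (g2 t')"
        using causal_curve_le[OF g1, of a1 s] causal_curve_le[OF g1, of s b1] causal_curve_le[OF g2, of a2 t']
          causal_curve_le[OF g2, of t' b2] lest[of s t] hs 3 st t' j by auto
      have "tau (g1 s) (g1 b1) + tau (g1 b1) (g2 t') \<le> tau (g1 s) (g2 t')"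
        using les by (intro reverse_triangle)
      then have low: "ennreal ((F b1 - F s) + (G t' - G a2)) \<le> tau (g1 s) (g2 t')"
        using Fs Gt j by (simp flip: ennreal_plus)
      have "tau (g1 a1) (g1 s) + tau (g1 s) (g2 t') + tau (g2 t') (g2 b2) \<le> tau (g1 a1) (g2 t') + tau (g2 t') (g2 b2)"
        using les by (intro add_right_mono reverse_triangle)
      also have "\<dots> \<le> tau (g1 a1) (g2 b2)"
        using les le_trans by (intro reverse_triangle) blast+
      finally have up: "ennreal (F s - F a1) + tau (g1 s) (g2 t') + ennreal (G b2 - G t')
          \<le> ennreal ((F b1 - F a1) + (G b2 - G a2))"
        unfolding add Fs Gt using Fs Gt by (simp flip: ennreal_plus)
      then have "tau (g1 s) (g2 t') \<noteq> top" by (auto simp: top_unique)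
      then obtain r where r: "0 \<le> r" "tau (g1 s) (g2 t') = ennreal r" by (cases "tau (g1 s) (g2 t')") auto
      have "(F b1 - F s) + (G t' - G a2) \<le> r" using low r by simp
      moreover have "F s - F a1 + r + (G b2 - G t') \<le> (F b1 - F a1) + (G b2 - G a2)"
        using up r Fs Gt by (simp flip: ennreal_plus)
      ultimately have "r = H t - H s" unfolding hs by linarith
      then show ?thesis using r hs by simp
    qed
  qed
  from tau_length_eq_potential[of a1 e H tau h, OF _ this]
  have "tau_length tau h a1 e = ennreal (H e - H a1)" using ab be by simp
  also have "H e - H a1 = (F b1 - F a1) + (G b2 - G a2)" using H1[of a1] H2[of e] ab be by (simp add: e_def)
  also have "ennreal \<dots> = tau (g1 a1) (g2 b2)"
    unfolding add using F[of a1 b1] G[of a2 b2] ab by (simp flip: ennreal_plus)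
  finally show thesis using that[of h] causal h1 h2 unfolding e_def by blast
qed

text \<open>The subbase sets are causally convex by push-up, and intersections preserve convexity
  while unions do not. The induction over the generated topology therefore proves that each point of
  an open set has a convex open neighbourhood inside it.\<close>

lemma causally_convex_neighbourhood:
  assumes sc: "strongly_causal ll" and W: "open W" "x \<in> W"
  obtains V where "open V" "x \<in> V" "V \<subseteq> W" "\<forall>p\<in>V. \<forall>q\<in>V. \<forall>r. le p r \<and> le r q \<longrightarrow> r \<in> V"
proof -
  let ?S = "{I_plus ll x \<inter> I_minus ll y | x y. True}"
  define c where "c V \<longleftrightarrow> open V \<and> (\<forall>p q r. p \<in> V \<and> q \<in> V \<and> le p r \<and> le r q \<longrightarrow> r \<in> V)" for V
  have c_Int: "c (V \<inter> V')" if "c V" "c V'" for V V'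
    using that unfolding c_def by (meson IntD1 IntD2 IntI open_Int)
  have eq: "topology_generated_by ?S = euclidean" using sc by (simp add: strongly_causal_def)
  have "openin (topology_generated_by ?S) W" unfolding eq using W(1) open_openin by blast
  then have "generate_topology_on ?S W" by (rule openin_topology_generated_by)
  then have "\<forall>x\<in>W. \<exists>V. c V \<and> x \<in> V \<and> V \<subseteq> W"
  proof (induction rule: generate_topology_on.induct)
    case (Int A B)
    show ?case
    proof
      fix x assume "x \<in> A \<inter> B"
      then obtain V V' where "c V" "x \<in> V" "V \<subseteq> A" "c V'" "x \<in> V'" "V' \<subseteq> B"
        using Int.IH by blast
      then show "\<exists>V. c V \<and> x \<in> V \<and> V \<subseteq> A \<inter> B"
        using c_Int by (intro exI[of _ "V \<inter> V'"]) auto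
    qed
  next
    case (UN Ks)
    show ?case
    proof
      fix x assume "x \<in> \<Union>Ks"
      then obtain A where A: "A \<in> Ks" "x \<in> A" by blast
      then obtain V where "c V \<and> x \<in> V \<and> V \<subseteq> A" using UN.IH by blast
      then show "\<exists>V. c V \<and> x \<in> V \<and> V \<subseteq> \<Union>Ks" using A by (intro exI[of _ V]) auto
    qed
  next
    case (Basis A)
    then obtain u v where A: "A = I_plus ll u \<inter> I_minus ll v" by blast
    have "open A"
      using topology_generated_by_Basis[OF Basis] unfolding eq using open_openin by blast
    moreover have "\<forall>p q r. p \<in> A \<and> q \<in> A \<and> le p r \<and> le r q \<longrightarrow> r \<in> A"
      unfolding A I_plus_def I_minus_def using ll_le_trans le_ll_trans by blast
    ultimately have "c A" unfolding c_def by (rule conjI)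
    then show ?case by blast
  qed simp
  then obtain V where "c V" "x \<in> V" "V \<subseteq> W" using W(2) by blast
  then show thesis using that[of V] unfolding c_def by blast
qed

end

subsection \<open>Limit curves\<close>

text \<open>By Tychonoff's theorem the sequence has a cluster point in the product. An uncountable
  product need not be sequentially compact, so no subsequence is claimed; instead any finitely many
  coordinates are approximated simultaneously, arbitrarily late in the sequence.\<close>

lemma pointwise_cluster_point:
  fixes h :: "nat \<Rightarrow> 'i \<Rightarrow> 'a::metric_space"
  assumes "compact S" "\<And>n i. h n i \<in> S"
  obtains f where "\<And>i. f i \<in> S"
    "\<And>I e N. finite I \<Longrightarrow> e > 0 \<Longrightarrow> \<exists>n\<ge>N. \<forall>i\<in>I. dist (h n i) (f i) < e"
proof -
  have "compactin (product_topology (\<lambda>_. euclidean) UNIV) (PiE UNIV (\<lambda>_::'i. S))"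
    using assms(1) by (subst compactin_PiE) auto
  then have comp: "compact (PiE UNIV (\<lambda>_::'i. S))"
    by (simp add: euclidean_product_topology)
  let ?F = "filtermap h sequentially"
  have "?F \<noteq> bot" by (simp add: filtermap_bot_iff)
  moreover have "eventually (\<lambda>f. f \<in> PiE UNIV (\<lambda>_::'i. S)) ?F"
    using assms(2) by (auto simp: eventually_filtermap PiE_UNIV_domain)
  ultimately obtain f where f: "f \<in> PiE UNIV (\<lambda>_::'i. S)" "inf (nhds f) ?F \<noteq> bot"
    using comp unfolding compact_filter by blast
  have "\<exists>n\<ge>N. \<forall>i\<in>I. dist (h n i) (f i) < e" if "finite I" "e > 0" for I e N
  proof (rule ccontr)
    assume none: "\<not> ?thesis"
    let ?O = "{k. \<forall>i\<in>I. k (id i) \<in> ball (f i) e}"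
    have "open ?O" using that by (intro product_topology_basis') auto
    then have "eventually (\<lambda>k. k \<in> ?O) (nhds f)"
      using that by (intro eventually_nhds_in_open) auto
    moreover have "eventually (\<lambda>k. k \<notin> ?O) ?F"
      unfolding eventually_filtermap eventually_sequentially
      using none by (intro exI[of _ N]) (auto simp: dist_commute)
    ultimately have "eventually (\<lambda>_. False) (inf (nhds f) ?F)"
      unfolding eventually_inf by (intro exI[of _ "\<lambda>k. k \<in> ?O"] exI[of _ "\<lambda>k. k \<notin> ?O"]) auto
    then show False using f(2) by (simp add: trivial_limit_def)
  qed
  then show thesis using f(1) by (intro that[of f]) auto
qed

context lorentzian_pre_length begin

text \<open>The Lipschitz bound and the causal relation involve two parameters at a time, so a
  pointwise cluster point of the reparametrized curves inherits both.\<close>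

lemma limit_causal_curve:
  assumes \<Omega>: "compact (closure \<Omega>)" "causally_closed le \<Omega>"
    and C: "0 \<le> C" "\<And>n. d_length (g n) (a n) (b n) \<le> ennreal C"
    and g: "\<And>n. fd_causal_curve le (g n) (a n) (b n)" "\<And>n. g n ` {a n..b n} \<subseteq> \<Omega>"
      "\<And>n. g n (a n) = y"
    and lim: "(\<lambda>n. g n (b n)) \<longlonglongrightarrow> q" and "y \<noteq> q"
  obtains h where "fd_causal_curve le h 0 1" "h 0 = y" "h 1 = q"
proof -
  have "\<exists>\<sigma>::real \<Rightarrow> real. (\<forall>s\<in>{0..1}. \<sigma> s \<in> {a n..b n}) \<and> C-lipschitz_on {0..1} (\<lambda>s. g n (\<sigma> s)) \<and>
      g n (\<sigma> 0) = g n (a n) \<and> g n (\<sigma> 1) = g n (b n) \<and>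
      (\<forall>s t. 0 \<le> s \<and> s \<le> t \<and> t \<le> 1 \<longrightarrow> le (g n (\<sigma> s)) (g n (\<sigma> t)))" for n
    by (rule arclength_reparametrization[OF g(1)[of n] C(2)[of n] C(1) reflp_le]) blast
  then obtain \<sigma> :: "nat \<Rightarrow> real \<Rightarrow> real" where \<sigma>: "\<And>n s. s \<in> {0..1} \<Longrightarrow> \<sigma> n s \<in> {a n..b n}"
      "\<And>n. C-lipschitz_on {0..1} (\<lambda>s. g n (\<sigma> n s))"
      "\<And>n. g n (\<sigma> n 0) = g n (a n)" "\<And>n. g n (\<sigma> n 1) = g n (b n)"
      "\<And>n s t. 0 \<le> s \<Longrightarrow> s \<le> t \<Longrightarrow> t \<le> 1 \<Longrightarrow> le (g n (\<sigma> n s)) (g n (\<sigma> n t))"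
    by metis
  \<comment> \<open>Constant extension beyond [0, 1], so that every real number may serve as an
    index of the product.\<close>
  define k where "k n s = g n (\<sigma> n (max 0 (min 1 s)))" for n s
  have k: "k n s = g n (\<sigma> n s)" if "s \<in> {0..1}" for n s using that by (simp add: k_def)
  have k_in: "k n s \<in> \<Omega>" for n s
    using g(2)[of n] \<sigma>(1)[of "max 0 (min 1 s)" n] unfolding k_def by fastforce
  obtain h where h: "\<And>s. h s \<in> closure \<Omega>"
      "\<And>I e N. finite I \<Longrightarrow> e > 0 \<Longrightarrow> \<exists>n\<ge>N. \<forall>i\<in>I. dist (k n i) (h i) < e"
    using pointwise_cluster_point[OF \<Omega>(1), of k] k_in closure_subset by (metis subsetD)
  \<comment> \<open>Where the sequence converges, its cluster value is the limit; this identifies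
    the end points.\<close>
  have ends: "h i = l" if l: "(\<lambda>n. k n i) \<longlonglongrightarrow> l" for i l
  proof (rule ccontr)
    assume "h i \<noteq> l"
    define e where "e = dist (h i) l / 2"
    have e: "e > 0" using \<open>h i \<noteq> l\<close> by (simp add: e_def)
    obtain N where N: "\<And>n. n \<ge> N \<Longrightarrow> dist (k n i) l < e" using l e unfolding lim_sequentially by blast
    obtain n where "n \<ge> N" "dist (k n i) (h i) < e" using h(2)[of "{i}" e N] e by auto
    then have "dist (h i) l < e + e"
      using N[of n] dist_triangle[of "h i" l "k n i"] by (simp add: dist_commute)
    then show False by (simp add: e_def)
  qed
  have h0: "h 0 = y" by (rule ends) (simp add: k \<sigma>(3) g(3))
  have h1: "h 1 = q" by (rule ends) (use lim in \<open>simp add: k \<sigma>(4)\<close>)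
  have "C-lipschitz_on {0..1} h"
  proof (rule lipschitz_onI)
    fix s t :: real assume st: "s \<in> {0..1}" "t \<in> {0..1}"
    show "dist (h s) (h t) \<le> C * dist s t"
    proof (rule field_le_epsilon)
      fix e :: real assume "e > 0"
      then obtain n where n: "dist (k n s) (h s) < e / 2" "dist (k n t) (h t) < e / 2"
        using h(2)[of "{s, t}" "e / 2" 0] by auto
      have "dist (k n s) (k n t) \<le> C * dist s t"
        using lipschitz_onD[OF \<sigma>(2) st] by (simp add: k[OF st(1)] k[OF st(2)])
      then show "dist (h s) (h t) \<le> C * dist s t + e"
        using n dist_triangle[of "h s" "h t" "k n s"] dist_triangle[of "k n s" "h t" "k n t"]
        by (simp add: dist_commute)
    qed
  qed (rule C)
  then have "loc_lipschitz_on {0..1} h" by (rule lipschitz_imp_loc_lipschitz_on)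
  moreover have "le (h s) (h t)" if st: "0 \<le> s" "s < t" "t \<le> 1" for s t
  proof -
    \<comment> \<open>Causal closedness speaks of convergent sequences, so indices are picked for
      this particular pair s, t with errors tending to 0.\<close>
    have "\<exists>n. dist (k n s) (h s) < inverse (real (Suc j)) \<and> dist (k n t) (h t) < inverse (real (Suc j))" for j
      using h(2)[of "{s, t}" "inverse (real (Suc j))" 0] by auto
    then obtain m where m: "\<And>j. dist (k (m j) s) (h s) < inverse (real (Suc j))"
        "\<And>j. dist (k (m j) t) (h t) < inverse (real (Suc j))" by metis
    have lim0: "(\<lambda>j. k (m j) i) \<longlonglongrightarrow> h i" if "\<And>j. dist (k (m j) i) (h i) < inverse (real (Suc j))" for i
    proof (rule tendstoI)
      fix e :: real assume "e > 0"
      then have "eventually (\<lambda>j. inverse (real (Suc j)) < e) sequentially"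
        using LIMSEQ_inverse_real_of_nat order_tendstoD(2) by blast
      then show "eventually (\<lambda>j. dist (k (m j) i) (h i) < e) sequentially"
        by eventually_elim (use that order.strict_trans in blast)
    qed
    have "le (k (m j) s) (k (m j) t)" for j
      using \<sigma>(5)[of s t "m j"] st by (simp add: k)
    then show ?thesis
      using \<Omega>(2)[unfolded causally_closed_def, rule_format, of "\<lambda>j. k (m j) s" "\<lambda>j. k (m j) t" "h s" "h t"]
        k_in h(1) lim0[OF m(1)] lim0[OF m(2)] by blast
  qed
  moreover have "\<exists>s\<in>{0..1}. \<exists>t\<in>{0..1}. h s \<noteq> h t"
    using h0 h1 \<open>y \<noteq> q\<close> by (intro bexI[of _ 0] bexI[of _ 1]) auto
  ultimately have "fd_causal_curve le h 0 1" unfolding fd_causal_curve_def by auto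
  then show thesis using h0 h1 by (rule that)
qed

subsection \<open>Comparison\<close>

text \<open>The property of a single neighbourhood in
  \<open>timelike_curvature_bounded_below\<close>, named so that a neighbourhood can be fixed and
  passed on.\<close>

definition comparison_nbhd :: "real \<Rightarrow> 'a set \<Rightarrow> bool" where
  "comparison_nbhd K U \<longleftrightarrow>
      (\<forall>x\<in>U. \<forall>y\<in>U. tau x y < \<infinity>) \<and> continuous_on (U \<times> U) (case_prod tau) \<and>
      (\<forall>x\<in>U. \<forall>y\<in>U. ll x y \<longrightarrow>
         (\<exists>g a b. fd_causal_curve le g a b \<and> g a = x \<and> g b = y \<and> g ` {a..b} \<subseteq> U \<and>
                  tau_length tau g a b = tau x y)) \<and>
      (\<forall>x y z al a1 b1 be a2 b2 ga a3 b3.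
         timelike_geodesic_triangle ll le tau x y z al a1 b1 be a2 b2 ga a3 b3 \<and>
         al ` {a1..b1} \<subseteq> U \<and> be ` {a2..b2} \<subseteq> U \<and> ga ` {a3..b3} \<subseteq> U \<and>
         timelike_size_bounds K (enn2real (tau x y)) (enn2real (tau y z)) (enn2real (tau x z)) \<longrightarrow>
         (\<forall>xb yb zb alb c1 d1 beb c2 d2 gab c3 d3.
            model_comparison_triangle K xb yb zb alb c1 d1 beb c2 d2 gab c3 d3 \<and>
            model_tau K xb yb = tau x y \<and> model_tau K yb zb = tau y z \<and> model_tau K xb zb = tau x z \<longrightarrow>
            (\<forall>p q pb qb.
               corresponding tau K x y al a1 b1 be a2 b2 ga a3 b3 xb yb alb c1 d1 beb c2 d2 gab c3 d3 p pb \<and>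
               corresponding tau K x y al a1 b1 be a2 b2 ga a3 b3 xb yb alb c1 d1 beb c2 d2 gab c3 d3 q qb \<longrightarrow>
               tau p q \<le> model_tau K pb qb)))"

lemma comparison_nbhdD:
  assumes "comparison_nbhd K U"
  shows "\<forall>x\<in>U. \<forall>y\<in>U. tau x y < \<infinity>"
    and "continuous_on (U \<times> U) (case_prod tau)"
    and "\<forall>x\<in>U. \<forall>y\<in>U. ll x y \<longrightarrow> (\<exists>g a b. fd_causal_curve le g a b \<and> g a = x \<and> g b = y \<and>
           g ` {a..b} \<subseteq> U \<and> tau_length tau g a b = tau x y)"
    and "\<lbrakk>timelike_geodesic_triangle ll le tau x y z al a1 b1 be a2 b2 ga a3 b3;
          al ` {a1..b1} \<subseteq> U; be ` {a2..b2} \<subseteq> U; ga ` {a3..b3} \<subseteq> U;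
          timelike_size_bounds K (enn2real (tau x y)) (enn2real (tau y z)) (enn2real (tau x z));
          model_comparison_triangle K xb yb zb alb c1 d1 beb c2 d2 gab c3 d3;
          model_tau K xb yb = tau x y; model_tau K yb zb = tau y z; model_tau K xb zb = tau x z;
          corresponding tau K x y al a1 b1 be a2 b2 ga a3 b3 xb yb alb c1 d1 beb c2 d2 gab c3 d3 p pb;
          corresponding tau K x y al a1 b1 be a2 b2 ga a3 b3 xb yb alb c1 d1 beb c2 d2 gab c3 d3 q qb\<rbrakk>
        \<Longrightarrow> tau p q \<le> model_tau K pb qb"
proof -
  note D = assms[unfolded comparison_nbhd_def]
  show "\<forall>x\<in>U. \<forall>y\<in>U. tau x y < \<infinity>" using D by (rule conjunct1)
  show "continuous_on (U \<times> U) (case_prod tau)" using D by (elim conjE)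
  show "\<forall>x\<in>U. \<forall>y\<in>U. ll x y \<longrightarrow> (\<exists>g a b. fd_causal_curve le g a b \<and> g a = x \<and> g b = y \<and>
           g ` {a..b} \<subseteq> U \<and> tau_length tau g a b = tau x y)"
    using D by (elim conjE)
  note D4 = D[THEN conjunct2, THEN conjunct2, THEN conjunct2, rule_format]
  show "tau p q \<le> model_tau K pb qb"
    if "timelike_geodesic_triangle ll le tau x y z al a1 b1 be a2 b2 ga a3 b3"
      "al ` {a1..b1} \<subseteq> U" "be ` {a2..b2} \<subseteq> U" "ga ` {a3..b3} \<subseteq> U"
      "timelike_size_bounds K (enn2real (tau x y)) (enn2real (tau y z)) (enn2real (tau x z))"
      "model_comparison_triangle K xb yb zb alb c1 d1 beb c2 d2 gab c3 d3"
      "model_tau K xb yb = tau x y" "model_tau K yb zb = tau y z" "model_tau K xb zb = tau x z"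
      "corresponding tau K x y al a1 b1 be a2 b2 ga a3 b3 xb yb alb c1 d1 beb c2 d2 gab c3 d3 p pb"
      "corresponding tau K x y al a1 b1 be a2 b2 ga a3 b3 xb yb alb c1 d1 beb c2 d2 gab c3 d3 q qb"
    by (rule D4[OF conjI[OF that(1) conjI[OF that(2) conjI[OF that(3) conjI[OF that(4,5)]]]]
          conjI[OF that(6) conjI[OF that(7) conjI[OF that(8,9)]]] conjI[OF that(10,11)]])
qed

text \<open>If the sides issuing from the first vertex overlap initially, the comparison triangle must be
  degenerate: in a nondegenerate one, the comparison point of \<open>al s = be r\<close> on the side \<open>al\<close>
  would be closer to the third vertex than \<open>be r\<close> is.\<close>

lemma degenerate_if_sides_overlap:
  assumes cmp: "comparison_nbhd K U"
    and small: "\<And>a b c u. \<lbrakk>0 < a; 0 < b; a + b < c; c < \<delta>; 0 < u; u < a\<rbrakk> \<Longrightarrow>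
       strict_model_triangle K a b c u \<and> timelike_size_bounds K a b c"
    and al: "fd_causal_curve le al a1 b1" "tau_length tau al a1 b1 = tau (al a1) (al b1)" "al ` {a1..b1} \<subseteq> U"
    and be: "fd_causal_curve le be a2 b2" "tau_length tau be a2 b2 = tau (be a2) (be b2)" "be ` {a2..b2} \<subseteq> U"
    and sr: "a1 \<le> s" "s \<le> b1" "a2 \<le> r" "r \<le> b2"
    and eq: "al a1 = be a2" "al s = be r"
    and ll: "ll (al a1) (al s)" "ll (al s) (al b1)" "ll (al b1) (be b2)"
    and d: "tau (al a1) (be b2) < ennreal \<delta>"
  shows "tau (al a1) (be b2) = tau (al a1) (al b1) + tau (al b1) (be b2)"
proof -
  have ab: "a1 < b1" "a2 < b2" using al be by (auto simp: fd_causal_curve_def)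
  have inU: "al a1 \<in> U" "al b1 \<in> U" "be a2 \<in> U" "be b2 \<in> U" using al(3) be(3) ab by auto
  have fin: "tau p q < \<infinity>" if "p \<in> U" "q \<in> U" for p q
    using comparison_nbhdD(1)[OF cmp] that by blast
  obtain F where F: "\<And>s u. a1 \<le> s \<Longrightarrow> s \<le> u \<Longrightarrow> u \<le> b1 \<Longrightarrow> F s \<le> F u \<and> tau (al s) (al u) = ennreal (F u - F s)"
    using maximal_potential[OF al(1,2)] fin inU by blast
  obtain G where G: "\<And>s u. a2 \<le> s \<Longrightarrow> s \<le> u \<Longrightarrow> u \<le> b2 \<Longrightarrow> G s \<le> G u \<and> tau (be s) (be u) = ennreal (G u - G s)"
    using maximal_potential[OF be(1,2)] fin inU by blast
  define a where "a = F b1 - F a1"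
  define c where "c = G b2 - G a2"
  define u where "u = F s - F a1"
  define b where "b = enn2real (tau (al b1) (be b2))"
  have a: "tau (al a1) (al b1) = ennreal a" and c: "tau (al a1) (be b2) = ennreal c"
    and u: "tau (al a1) (al s) = ennreal u" and a_u: "tau (al s) (al b1) = ennreal (a - u)"
    and b: "tau (al b1) (be b2) = ennreal b"
    using F[of a1 b1] F[of a1 s] F[of s b1] G[of a2 b2] ab sr eq fin[OF inU(2,4)]
    by (auto simp: a_def c_def u_def b_def)
  have "0 < u" "u < a" "0 < b"
    using ll u a_u b tau_pos_iff by (metis ennreal_less_zero_iff diff_gt_0_iff_gt)+
  have c0: "0 \<le> c" using G[of a2 b2] ab by (simp add: c_def)
  have "ennreal u = ennreal (G r - G a2)" using u eq G[of a2 r] sr by simp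
  \<comment> \<open>The common point has the same separation u from the common start along both
    curves, so what remains of be has length c - u.\<close>
  then have "u = G r - G a2" using \<open>0 < u\<close> G[of a2 r] sr by simp
  then have c_u: "tau (al s) (be b2) = ennreal (c - u)" "u \<le> c"
    using G[of r b2] sr eq by (auto simp: c_def)
  have "tau (al a1) (al b1) + tau (al b1) (be b2) \<le> tau (al a1) (be b2)"
    using ll ll_imp_le le_trans by (intro reverse_triangle) blast+
  then have abc: "a + b \<le> c"
    using \<open>0 < u\<close> \<open>u < a\<close> \<open>0 < b\<close> c0 unfolding a b c by (simp flip: ennreal_plus)
  have "\<not> a + b < c"
  proof
    assume abc: "a + b < c"
    have "c < \<delta>" using d c c0 by (simp add: ennreal_less_iff)
    then have st: "strict_model_triangle K a b c u" and sz: "timelike_size_bounds K a b c"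
      using small[of a b c u] abc \<open>0 < u\<close> \<open>u < a\<close> \<open>0 < b\<close> by auto
    obtain x y z p f a' g b' h c' where M: "model_comparison_triangle K x y z f 0 a' g 0 b' h 0 c'"
      "model_tau K x y = ennreal a" "model_tau K y z = ennreal b" "model_tau K x z = ennreal c"
      and p: "p \<in> f ` {0..a'}" "model_tau K x p = ennreal u" "model_tau K p z < ennreal (c - u)"
      using st unfolding strict_model_triangle_def by blast
    obtain k a3 b3 where k: "fd_causal_curve le k a3 b3" "k a3 = al b1" "k b3 = be b2" "k ` {a3..b3} \<subseteq> U"
        "tau_length tau k a3 b3 = tau (al b1) (be b2)"
      using comparison_nbhdD(3)[OF cmp] inU ll(3) by blast
    have tri: "timelike_geodesic_triangle ll le tau (al a1) (al b1) (be b2) al a1 b1 k a3 b3 be a2 b2"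
      unfolding timelike_geodesic_triangle_def
      using al be k ll eq fin[OF inU(1,4)] ll_le_trans[OF ll(1) ll_imp_le[OF ll(2)]] by auto
    have size: "timelike_size_bounds K (enn2real (tau (al a1) (al b1))) (enn2real (tau (al b1) (be b2)))
        (enn2real (tau (al a1) (be b2)))"
      using sz \<open>0 < u\<close> \<open>u < a\<close> \<open>0 < b\<close> c0 by (simp add: a b c)
    \<comment> \<open>The vertex \<open>be b2\<close> is matched with z as an end point of the third
      side, while \<open>al s\<close> is matched with p on the first.\<close>
    have "h c' = z" "0 < c'" using M(1)
      unfolding model_comparison_triangle_def timelike_geodesic_triangle_def fd_causal_curve_def by auto
    then have "z \<in> h ` {0..c'}" by force
    moreover have "be b2 \<in> be ` {a2..b2}" using ab by simp
    ultimately have cz: "corresponding tau K (al a1) (al b1) al a1 b1 k a3 b3 be a2 b2 x y f 0 a' g 0 b' h 0 c' (be b2) z"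
      unfolding corresponding_def using M c by auto
    have "al s \<in> al ` {a1..b1}" using sr by simp
    then have cp: "corresponding tau K (al a1) (al b1) al a1 b1 k a3 b3 be a2 b2 x y f 0 a' g 0 b' h 0 c' (al s) p"
      unfolding corresponding_def using p u by auto
    have M': "model_tau K x y = tau (al a1) (al b1)" "model_tau K y z = tau (al b1) (be b2)"
        "model_tau K x z = tau (al a1) (be b2)"
      using M a b c by auto
    have "tau (al s) (be b2) \<le> model_tau K p z"
      using comparison_nbhdD(4)[OF cmp tri al(3) k(4) be(3) size M(1) M' cp cz] .
    then show False using p(3) unfolding c_u by simp
  qed
  then have "c = a + b" using abc by simp
  then show ?thesis unfolding a b c using \<open>0 < u\<close> \<open>u < a\<close> \<open>0 < b\<close> by (simp flip: ennreal_plus)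
qed

end

subsection \<open>Branching\<close>

text \<open>The situation near a branching point that both alternatives start from. Curvature enters
  only through \<open>degenerate\<close>.\<close>

locale local_branching = lorentzian_pre_length ll le tau
  for ll le :: "'a::metric_space \<Rightarrow> 'a \<Rightarrow> bool" and tau :: "'a \<Rightarrow> 'a \<Rightarrow> ennreal" +
  fixes V :: "'a set" and al be :: "real \<Rightarrow> 'a" and s0 t s1 :: real
  assumes convex: "\<And>p q r. p \<in> V \<Longrightarrow> q \<in> V \<Longrightarrow> le p r \<Longrightarrow> le r q \<Longrightarrow> r \<in> V"
    and finite_tau: "\<And>p q. p \<in> V \<Longrightarrow> q \<in> V \<Longrightarrow> tau p q < \<infinity>"
    and cont_tau: "continuous_on (V \<times> V) (case_prod tau)"
    and t: "s0 < t" "t < s1"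
    and timelike: "fd_timelike_curve ll al s0 s1" "fd_timelike_curve ll be s0 s1"
    and al_in: "\<And>s. s0 \<le> s \<Longrightarrow> s \<le> s1 \<Longrightarrow> al s \<in> V"
    and be_in: "\<And>s. s0 \<le> s \<Longrightarrow> s \<le> s1 \<Longrightarrow> be s \<in> V"
    and al_max: "\<And>u v. s0 \<le> u \<Longrightarrow> u < v \<Longrightarrow> v \<le> s1 \<Longrightarrow> tau_length tau al u v = tau (al u) (al v)"
    and be_max: "\<And>u v. s0 \<le> u \<Longrightarrow> u < v \<Longrightarrow> v \<le> s1 \<Longrightarrow> tau_length tau be u v = tau (be u) (be v)"
    and start: "al s0 = be s0" "al t = be t"
    and branch: "al ` {t..s1} \<inter> be ` {t..s1} = {al t}"
    and degenerate: "\<And>s r. t < s \<Longrightarrow> s \<le> s1 \<Longrightarrow> t < r \<Longrightarrow> r \<le> s1 \<Longrightarrow> ll (al s) (be r) \<Longrightarrow>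
      tau (al s0) (be r) = tau (al s0) (al s) + tau (al s) (be r)"
begin

lemma not_ll_in_V: "p \<in> V \<Longrightarrow> \<not> ll p p"
  using finite_tau not_ll_self by blast

lemma al_ll: "s0 \<le> u \<Longrightarrow> u < v \<Longrightarrow> v \<le> s1 \<Longrightarrow> ll (al u) (al v)"
  and be_ll: "s0 \<le> u \<Longrightarrow> u < v \<Longrightarrow> v \<le> s1 \<Longrightarrow> ll (be u) (be v)"
  using timelike unfolding fd_timelike_curve_def by auto

lemma al_causal: "s0 \<le> u \<Longrightarrow> u < v \<Longrightarrow> v \<le> s1 \<Longrightarrow> fd_causal_curve le al u v"
  and be_causal: "s0 \<le> u \<Longrightarrow> u < v \<Longrightarrow> v \<le> s1 \<Longrightarrow> fd_causal_curve le be u v"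
  using timelike timelike_imp_causal timelike_curve_restrict finite_tau al_in be_in
  by (meson less_le_trans less_imp_le)+

lemma cont_be: "continuous_on {s0..s1} be"
  using fd_causal_curve_continuous be_causal t by (meson less_trans order_refl)

lemma cont_al: "continuous_on {s0..s1} al"
  using fd_causal_curve_continuous al_causal t by (meson less_trans order_refl)

text \<open>Past the branching point the images are disjoint by \<open>branch\<close>; a meeting
  with the common part or with be before t would close a timelike loop.\<close>

lemma disjoint_after_branching:
  assumes "t < s" "s \<le> s1" "s0 \<le> r" "r \<le> s1"
  shows "al s \<noteq> be r"
proof
  assume eq: "al s = be r"
  have lls: "ll (al t) (al s)" using al_ll t assms by auto
  show False
  proof (cases "r \<le> t")
    case True
    then have "le (be r) (be t)" using be_ll[of r t] assms t ll_imp_le le_refl by (cases "r = t") auto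
    then have "ll (al s) (al s)" using le_ll_trans lls eq start by metis
    then show False using not_ll_in_V al_in assms t by force
  next
    case False
    then have "be r \<in> be ` {t..s1}" using assms by simp
    moreover have "al s \<in> al ` {t..s1}" using assms by simp
    ultimately have "al s \<in> al ` {t..s1} \<inter> be ` {t..s1}" using eq by simp
    then have "al s = al t" using branch by simp
    then show False using lls not_ll_in_V[of "al t"] al_in[of t] t by simp
  qed
qed

text \<open>The relation \<open>ll\<close> is open by lower semicontinuity of \<open>tau\<close>,
  and it holds between the branching point and \<open>be s1\<close>.\<close>

lemma ll_end_near_branching:
  obtains s where "t < s" "s \<le> s1" "ll (al s) (be s1)"
proof -
  let ?O = "{p. 0 < case_prod tau p}"
  have op: "open ?O" by (rule open_tau_greater)
  have "(al t, be s1) \<in> ?O" using be_ll[of t s1] t start tau_pos_iff by simp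
  then obtain A B where AB: "open A" "open B" "al t \<in> A" "be s1 \<in> B" "A \<times> B \<subseteq> ?O"
    using open_prod_elim[OF op] by (metis mem_Sigma_iff)
  obtain D where D: "open D" "t \<in> D" "\<forall>y\<in>{s0..s1}. y \<in> D \<longrightarrow> al y \<in> A"
    using cont_al AB(1,3) t unfolding continuous_on_topological
    by (metis atLeastAtMost_iff less_imp_le)
  then obtain e where e: "e > 0" "\<And>y. dist y t < e \<Longrightarrow> y \<in> D" unfolding open_dist by blast
  define s where "s = min s1 (t + e / 2)"
  have s: "t < s" "s \<le> s1" "dist s t < e" using e t by (auto simp: s_def dist_real_def)
  then have "al s \<in> A" using D(3) e(2) t by auto
  then have "ll (al s) (be s1)" using AB(4,5) tau_pos_iff by auto
  then show thesis using s that by blast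
qed

lemma between_in_V:
  assumes "fd_causal_curve le g a b" "g a \<in> V" "g b \<in> V"
  shows "g ` {a..b} \<subseteq> V"
  using causal_curve_le[OF assms(1)] convex[OF assms(2,3)] by fastforce

text \<open>Uniqueness concerns images only. This is enough: it puts the point \<open>al s\<close>,
  where the concatenation leaves al, on be.\<close>

lemma not_uniquely_geodesic:
  assumes V: "V \<subseteq> U"
    and uni: "\<forall>p\<in>U. \<forall>q\<in>U. ll p q \<longrightarrow>
         (\<exists>g a b. fd_causal_curve le g a b \<and> maximal_curve tau g a b \<and>
                  g a = p \<and> g b = q \<and> g ` {a..b} \<subseteq> U) \<and>
         (\<forall>g a b h a' b'.
            fd_causal_curve le g a b \<and> maximal_curve tau g a b \<and> g a = p \<and> g b = q \<and> g ` {a..b} \<subseteq> U \<and>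
            fd_causal_curve le h a' b' \<and> maximal_curve tau h a' b' \<and> h a' = p \<and> h b' = q \<and> h ` {a'..b'} \<subseteq> U
            \<longrightarrow> g ` {a..b} = h ` {a'..b'})"
  shows False
proof -
  obtain s where s: "t < s" "s \<le> s1" "ll (al s) (be s1)" by (rule ll_end_near_branching)
  have inV: "al s0 \<in> V" "al s \<in> V" "be s1 \<in> V" using al_in be_in s t by auto
  obtain g a b where g: "fd_causal_curve le g a b" "maximal_curve tau g a b" "g a = al s" "g b = be s1"
    using uni[rule_format, OF _ _ s(3), THEN conjunct1] inV V by blast
  have als: "fd_causal_curve le al s0 s" "tau_length tau al s0 s = tau (al s0) (al s)"
    using al_causal al_max s t by auto
  have bes: "fd_causal_curve le be s0 s1" "maximal_curve tau be s0 s1"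
    using be_causal be_max t by (auto simp: maximal_curve_def)
  have add: "tau (al s0) (g b) = tau (al s0) (al s) + tau (g a) (g b)"
    using degenerate[OF s(1,2) t(2) order_refl s(3)] g by simp
  have fin: "tau (al s0) (g b) < \<infinity>" using finite_tau inV g by simp
  define e where "e = s + (b - a)"
  obtain h where h: "fd_causal_curve le h s0 e" "tau_length tau h s0 e = tau (al s0) (g b)"
      "\<And>v. v \<le> s \<Longrightarrow> h v = al v" "\<And>v. s \<le> v \<Longrightarrow> h v = g (v - s + a)"
    unfolding e_def
    using concat_maximal[OF als(1) g(1) g(3)[symmetric] als(2) g(2)[unfolded maximal_curve_def] add fin] by blast
  have ab: "a < b" using g(1) by (simp add: fd_causal_curve_def)
  have h_ends: "h s0 = al s0" "h e = be s1" using h(3)[of s0] h(4)[of e] s t ab g by (auto simp: e_def)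
  have ends: "al s0 \<in> U" "be s1 \<in> U" "ll (al s0) (be s1)"
    using inV V be_ll[of s0 s1] t start by auto
  have h_max: "maximal_curve tau h s0 e" using h(2) h_ends g by (simp add: maximal_curve_def)
  have h_in: "h ` {s0..e} \<subseteq> U" using between_in_V[OF h(1)] h_ends inV V by simp
  have be_in: "be ` {s0..s1} \<subseteq> U" using between_in_V[OF bes(1)] inV start V by simp
  have "h ` {s0..e} = be ` {s0..s1}"
    by (rule uni[rule_format, OF ends, THEN conjunct2, rule_format])
      (intro conjI h(1) h_max h_ends h_in bes start(1)[symmetric] refl be_in)
  moreover have "h s \<in> h ` {s0..e}" using s t ab by (simp add: e_def)
  ultimately obtain r where "h s = be r" "s0 \<le> r" "r \<le> s1" by force
  then show False using disjoint_after_branching[OF s(1,2)] h(3)[of s] by simp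
qed

lemma no_strictly_longer_timelike_curves:
  assumes V: "V \<subseteq> \<Omega>" and \<Omega>: "compact (closure \<Omega>)" "causally_closed le \<Omega>"
    and ex: "\<And>p q. p \<in> \<Omega> \<Longrightarrow> q \<in> \<Omega> \<Longrightarrow> ll p q \<Longrightarrow>
      \<exists>g a b. fd_timelike_curve ll g a b \<and> maximal_curve tau g a b \<and> g a = p \<and> g b = q \<and> g ` {a..b} \<subseteq> \<Omega> \<and>
        (\<forall>h a' b'. fd_causal_curve le h a' b' \<and> h a' = p \<and> h b' = q \<and>
           h ` {a'..b'} \<subseteq> \<Omega> \<and> contains_null_segment ll le h a' b' \<longrightarrow>
           tau_length tau h a' b' < tau_length tau g a b)"
    and C: "C > 0" "\<And>h a b. fd_causal_curve le h a b \<Longrightarrow> h ` {a..b} \<subseteq> \<Omega> \<Longrightarrow> d_length h a b \<le> ennreal C"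
  shows False
proof -
  obtain s where s: "t < s" "s \<le> s1" "ll (al s) (be s1)" by (rule ll_end_near_branching)
  define y where "y = al s"
  define p where "p = al s0"
  have inV: "p \<in> V" "y \<in> V" using al_in s t by (auto simp: p_def y_def)
  have py: "ll p y" using al_ll[of s0 s] s t by (simp add: p_def y_def)
  \<comment> \<open>By push-up R is closed upwards in [t, s1], so every parameter beyond its infimum
    belongs to it (\<open>after\<close>).\<close>
  define R where "R = {r \<in> {t..s1}. ll y (be r)}"
  have s1R: "s1 \<in> R" using s t by (simp add: R_def y_def)
  have bdd: "bdd_below R" by (rule bdd_belowI[of _ t]) (simp add: R_def)
  define r0 where "r0 = Inf R"
  have r0: "t \<le> r0" "r0 \<le> s1"
  proof -
    show "t \<le> r0" unfolding r0_def using s1R by (intro cInf_greatest) (auto simp: R_def)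
    show "r0 \<le> s1" unfolding r0_def by (rule cInf_lower[OF s1R bdd])
  qed
  have after: "ll y (be r)" if r: "r0 < r" "r \<le> s1" for r
  proof -
    obtain r' where r': "r' \<in> R" "r' < r"
      using r(1) cInf_less_iff[OF _ bdd, of r] s1R by (auto simp: r0_def)
    then have "le (be r') (be r)" using be_ll[of r' r] r t ll_imp_le by (auto simp: R_def)
    then show ?thesis using r' ll_le_trans by (auto simp: R_def)
  qed
  define q where "q = be r0"
  have qV: "q \<in> V" using be_in r0 t by (simp add: q_def)
  have tau_cont: "continuous_on {s0..s1} (\<lambda>r. tau v (be r))" if "v \<in> V" for v
  proof -
    have "continuous_on {s0..s1} (\<lambda>r. case_prod tau (v, be r))"
      by (rule continuous_on_compose2[OF cont_tau]) (use that be_in cont_be in \<open>auto intro!: continuous_intros\<close>)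
    then show ?thesis by simp
  qed
  \<comment> \<open>Otherwise continuity of \<open>tau\<close> would put parameters below r0 into R;
    r0 = t is excluded because \<open>ll (al t) y\<close> would then close a loop at y.\<close>
  have not_ll: "\<not> ll y q"
  proof
    assume yq: "ll y q"
    have "t < r0"
    proof (rule ccontr)
      assume "\<not> t < r0"
      then have "q = al t" using r0 start by (simp add: q_def)
      moreover have "ll (al t) y" using al_ll[of t s] s t by (simp add: y_def)
      ultimately show False using yq ll_le_trans ll_imp_le not_ll_in_V inV by blast
    qed
    have "r0 \<in> {s0..s1}" "tau y (be r0) \<in> {0<..}"
      using yq r0 t tau_pos_iff[of y q] by (auto simp: q_def)
    then obtain A where A: "open A" "r0 \<in> A" "\<forall>r\<in>{s0..s1}. r \<in> A \<longrightarrow> tau y (be r) \<in> {0<..}"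
      using tau_cont[OF inV(2), unfolded continuous_on_topological, rule_format, of r0 "{0<..}"] by auto
    obtain e where e: "e > 0" "\<And>r. dist r r0 < e \<Longrightarrow> r \<in> A" using A(1,2) unfolding open_dist by blast
    define r where "r = max t (r0 - e / 2)"
    have r: "t \<le> r" "r < r0" "dist r r0 < e" using \<open>t < r0\<close> e by (auto simp: r_def dist_real_def)
    then have "0 < tau y (be r)" using A(3) e(2) r0 t by auto
    then have "r \<in> R" using r r0 tau_pos_iff by (auto simp: R_def)
    then show False using r(2) cInf_lower[OF _ bdd] by (force simp: r0_def)
  qed
  then have r0_less: "r0 < s1" using s r0 by (cases "r0 = s1") (auto simp: q_def y_def)
  \<comment> \<open>The parameters decrease to r0 from above, where \<open>after\<close> provides
    \<open>ll y (be r)\<close> and hence additivity.\<close>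
  define rn where "rn n = r0 + (s1 - r0) / real (Suc n)" for n
  have rn: "r0 < rn n" "rn n \<le> s1" for n
    using r0_less by (auto simp: rn_def field_simps intro!: mult_right_mono)
  have rn_lim: "rn \<longlonglongrightarrow> r0"
  proof -
    have "(\<lambda>n. r0 + (s1 - r0) * inverse (real (Suc n))) \<longlonglongrightarrow> r0 + (s1 - r0) * 0"
      by (intro tendsto_intros LIMSEQ_inverse_real_of_nat)
    then show ?thesis by (simp add: rn_def[abs_def] divide_inverse)
  qed
  have r0_in: "r0 \<in> {s0..s1}" using r0 t by simp
  have "rn n \<in> {s0..s1}" for n using r0(1) rn[of n] t by simp
  then have rn_in: "\<forall>\<^sub>F n in sequentially. rn n \<in> {s0..s1}" by simp
  have lim: "(\<lambda>n. tau v (be (rn n))) \<longlonglongrightarrow> tau v q" if "v \<in> V" for v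
    unfolding q_def by (rule continuous_on_tendsto_compose[OF tau_cont[OF that] rn_lim r0_in rn_in])
  have "tau p (be (rn n)) = tau p y + tau y (be (rn n))" for n
    using degenerate[OF s(1,2), of "rn n"] rn[of n] r0 after[of "rn n"] by (simp add: p_def y_def)
  then have "(\<lambda>n. tau p y + tau y (be (rn n))) \<longlonglongrightarrow> tau p q" using lim[OF inV(1)] by simp
  moreover have "(\<lambda>n. tau p y + tau y (be (rn n))) \<longlonglongrightarrow> tau p y + tau y q"
    using lim[OF inV(2)] by (intro tendsto_add tendsto_const)
  ultimately have add: "tau p q = tau p y + tau y q" using LIMSEQ_unique by blast
  have yq0: "tau y q = 0" using not_ll tau_pos_iff[of y q] by (simp add: zero_less_iff_neq_zero)
  have "y \<noteq> q" using disjoint_after_branching[OF s(1,2), of r0] r0 t by (simp add: y_def q_def)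
  have "\<exists>g a b. fd_causal_curve le g a b \<and> g a = y \<and> g b = be (rn n) \<and> g ` {a..b} \<subseteq> \<Omega>" for n
    using ex[of y "be (rn n)"] after[OF rn] inV V be_in[of "rn n"] rn[of n] r0 t timelike_imp_causal
    by (meson less_imp_le order.trans subsetD)
  then obtain g a b where g: "\<And>n. fd_causal_curve le (g n) (a n) (b n)" "\<And>n. g n (a n) = y"
      "\<And>n. g n (b n) = be (rn n)" "\<And>n. g n ` {a n..b n} \<subseteq> \<Omega>"
    by metis
  have "(\<lambda>n. be (rn n)) \<longlonglongrightarrow> q"
    unfolding q_def by (rule continuous_on_tendsto_compose[OF cont_be rn_lim r0_in rn_in])
  then have "(\<lambda>n. g n (b n)) \<longlonglongrightarrow> q" by (simp add: g(3))
  then obtain k where k: "fd_causal_curve le k 0 1" "k 0 = y" "k 1 = q"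
    using limit_causal_curve[where g = g and a = a and b = b, OF \<Omega> less_imp_le[OF C(1)] C(2)[OF g(1,4)] g(1,4,2) _ \<open>y \<noteq> q\<close>] by blast
  \<comment> \<open>A timelike pair on k would give \<open>ll y q\<close> by push-up from both
    ends.\<close>
  have not_ll_k: "\<not> ll (k u) (k v)" if uv: "u \<in> {0..1}" "v \<in> {0..1}" for u v
  proof
    assume *: "ll (k u) (k v)"
    have "le y (k u)" "le (k v) q"
      using causal_curve_le[OF k(1), of 0 u] causal_curve_le[OF k(1), of v 1] uv k by auto
    then show False using * not_ll le_ll_trans ll_le_trans by blast
  qed
  \<comment> \<open>The bound \<open>tau y q\<close> is 0, so the null curve k is maximal for
    trivial reasons and may be fed to \<open>concat_maximal\<close>.\<close>
  have "tau_length tau k 0 1 \<le> tau y q"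
    using tau_length_le_refined[of 0 0 1 1 tau k] k yq0
      tau_self_eq_0[OF finite_tau[OF inV(2,2)]] tau_self_eq_0[OF finite_tau[OF qV qV]] by simp
  then have k_max: "tau_length tau k 0 1 = tau (k 0) (k 1)" using yq0 k by simp
  have als: "fd_causal_curve le al s0 s" "tau_length tau al s0 s = tau (al s0) (al s)"
    using al_causal al_max s t by auto
  have j: "al s = k 0" using k by (simp add: y_def)
  have add': "tau (al s0) (k 1) = tau (al s0) (al s) + tau (k 0) (k 1)"
    using add k by (simp add: p_def y_def)
  have fin: "tau (al s0) (k 1) < \<infinity>" using finite_tau inV qV k by (simp add: p_def)
  define e where "e = s + (1 - 0 :: real)"
  obtain h where h: "fd_causal_curve le h s0 e" "tau_length tau h s0 e = tau (al s0) (k 1)"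
      "\<And>v. v \<le> s \<Longrightarrow> h v = al v" "\<And>v. s \<le> v \<Longrightarrow> h v = k (v - s + 0)"
    unfolding e_def using concat_maximal[OF als(1) k(1) j als(2) k_max add' fin] by blast
  have hk: "h v = k (v - s)" if "s \<le> v" for v using h(4)[OF that] by simp
  obtain L where "L-lipschitz_on {s0..e} h" by (rule fd_causal_curve_lipschitz[OF h(1)])
  then have "loc_lipschitz_on {s..e} h"
    using s t by (intro lipschitz_imp_loc_lipschitz_on[OF lipschitz_on_subset]) auto
  moreover have "\<exists>u\<in>{s..e}. \<exists>v\<in>{s..e}. h u \<noteq> h v"
    using hk[of s] hk[of e] k \<open>y \<noteq> q\<close> by (intro bexI[of _ s] bexI[of _ e]) (auto simp: e_def)
  moreover have "\<not> ll (h u) (h v)" if "u \<in> {s..e}" "v \<in> {s..e}" for u v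
    using not_ll_k[of "u - s" "v - s"] hk[of u] hk[of v] that by (simp add: e_def)
  ultimately have "null_curve ll le h s e"
    using h(1) s t unfolding null_curve_def fd_causal_curve_def by (auto simp: e_def)
  then have null: "contains_null_segment ll le h s0 e"
    unfolding contains_null_segment_def using s t by (intro exI[of _ s] exI[of _ e]) (auto simp: e_def)
  have "p \<in> \<Omega>" "q \<in> \<Omega>" using inV qV V by auto
  moreover have "ll p q"
    using py add yq0 tau_pos_iff[of p y] tau_pos_iff[of p q] by simp
  ultimately have "\<exists>g a b. fd_timelike_curve ll g a b \<and> maximal_curve tau g a b \<and> g a = p \<and> g b = q \<and> g ` {a..b} \<subseteq> \<Omega> \<and>
        (\<forall>h a' b'. fd_causal_curve le h a' b' \<and> h a' = p \<and> h b' = q \<and>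
           h ` {a'..b'} \<subseteq> \<Omega> \<and> contains_null_segment ll le h a' b' \<longrightarrow>
           tau_length tau h a' b' < tau_length tau g a b)"
    by (rule ex)
  then obtain g' a' b' where g': "maximal_curve tau g' a' b'" "g' a' = p" "g' b' = q"
    and longer: "\<forall>h a b. fd_causal_curve le h a b \<and> h a = p \<and> h b = q \<and> h ` {a..b} \<subseteq> \<Omega> \<and>
        contains_null_segment ll le h a b \<longrightarrow> tau_length tau h a b < tau_length tau g' a' b'"
    by (elim exE conjE) (rule that)
  have "h s0 = p" "h e = q" using h(3)[of s0] hk[of e] s t k by (auto simp: p_def e_def)
  \<comment> \<open>Only the end points of the limit curve are known; causal convexity of V confines
    h.\<close>
  moreover have "h ` {s0..e} \<subseteq> \<Omega>" using between_in_V[OF h(1)] calculation inV qV V by auto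
  ultimately have "tau_length tau h s0 e < tau p q"
    using longer[rule_format, of h s0 e] h(1) null g' by (simp add: maximal_curve_def)
  then show False using h(2) k by (simp add: p_def)
qed

end

section \<open>Localization at the branching point\<close>

theorem theorem4p12:
  fixes ll le :: "'a::metric_space \<Rightarrow> 'a \<Rightarrow> bool"
    and tau :: "'a \<Rightarrow> 'a \<Rightarrow> ennreal"
    and K :: real
  assumes "lorentzian_pre_length_space ll le tau"
    and "strongly_causal ll"
    and "timelike_curvature_bounded_below ll le tau K"
    and "condition_i ll le tau \<or> timelike_locally_uniquely_geodesic ll le tau"
  shows "\<forall>g a b t. fd_timelike_curve ll g a b \<and> maximal_curve tau g a b \<longrightarrow>
           \<not> timelike_branching_point ll le tau g a b t"
proof (intro allI impI notI)
  fix g a b t assume br: "timelike_branching_point ll le tau g a b t"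
  interpret lorentzian_pre_length ll le tau by unfold_locales (rule assms(1))
  have curv: "\<exists>U. neighbourhood U x \<and> comparison_nbhd K U" for x
    using assms(3) unfolding timelike_curvature_bounded_below_def comparison_nbhd_def by (rule spec)
  obtain al be c where c: "b < c" and at: "a < t" "t < b"
    and al: "maximal_curve tau al a c" "fd_timelike_curve ll al a c"
    and be: "maximal_curve tau be a c" "fd_timelike_curve ll be a c"
    and same: "\<forall>s\<in>{a..t}. al s = g s \<and> be s = g s" and branch: "al ` {t..c} \<inter> be ` {t..c} = {g t}"
    using br unfolding timelike_branching_point_def by blast
  define x where "x = g t"
  have x: "al t = x" "be t = x" using same at by (auto simp: x_def)
  obtain \<delta> where \<delta>: "0 < \<delta>"
    and small: "\<And>a b c u. \<lbrakk>0 < a; 0 < b; a + b < c; c < \<delta>; 0 < u; u < a\<rbrakk> \<Longrightarrow>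
       strict_model_triangle K a b c u \<and> timelike_size_bounds K a b c"
    using small_strict_model_triangle[of K] by blast
  obtain U where U: "neighbourhood U x" "comparison_nbhd K U" using curv by blast
  obtain U0 where U0: "open U0" "x \<in> U0" "U0 \<subseteq> U" using U(1) unfolding neighbourhood_def by blast
  \<comment> \<open>W is the neighbourhood supplied by either alternative. The data of
    \<open>local_branching\<close> are built once inside it, and the contradiction specific to the
    alternative is left to \<open>contra\<close>.\<close>
  have no_branching: False if W: "neighbourhood W x"
    and contra: "\<And>V s0 s1. local_branching ll le tau V al be s0 t s1 \<Longrightarrow> V \<subseteq> W \<Longrightarrow> False" for W
  proof -
    obtain W0 where W0: "open W0" "x \<in> W0" "W0 \<subseteq> W" using W unfolding neighbourhood_def by blast
    have xU: "x \<in> U" using U0 by blast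
    \<comment> \<open>Continuity at (x, x) then makes all separations near x smaller than \<delta>,
      the size for which model triangles are available.\<close>
    have "tau x x = 0" using comparison_nbhdD(1)[OF U(2)] xU tau_self_eq_0 by blast
    then have "case_prod tau (x, x) \<in> {..<ennreal \<delta>}" using \<delta> by simp
    then obtain A where A: "open A" "(x, x) \<in> A" "\<forall>p\<in>U \<times> U. p \<in> A \<longrightarrow> case_prod tau p \<in> {..<ennreal \<delta>}"
      using comparison_nbhdD(2)[OF U(2)] xU unfolding continuous_on_topological
      by (metis SigmaI open_lessThan)
    obtain A1 A2 where A12: "open A1" "open A2" "x \<in> A1" "x \<in> A2" "A1 \<times> A2 \<subseteq> A"
      using open_prod_elim[OF A(1,2)] by (metis mem_Sigma_iff)
    have N: "open (U0 \<inter> W0 \<inter> A1 \<inter> A2)" "x \<in> U0 \<inter> W0 \<inter> A1 \<inter> A2"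
      using U0 W0 A12 by auto
    obtain V where V: "open V" "x \<in> V" "V \<subseteq> U0 \<inter> W0 \<inter> A1 \<inter> A2"
      and convex: "\<forall>p\<in>V. \<forall>q\<in>V. \<forall>r. le p r \<and> le r q \<longrightarrow> r \<in> V"
      by (rule causally_convex_neighbourhood[OF assms(2) N])
    have VU: "V \<subseteq> U" using V(3) U0(3) by blast
    have tauV: "tau p q < ennreal \<delta>" if "p \<in> V" "q \<in> V" for p q
    proof -
      have "(p, q) \<in> A" "(p, q) \<in> U \<times> U" using that V(3) VU A12(5) by auto
      then have "case_prod tau (p, q) \<in> {..<ennreal \<delta>}" using A(3) by blast
      then show ?thesis by simp
    qed
    have finV: "tau p q < \<infinity>" if "p \<in> V" "q \<in> V" for p q
      using tauV[OF that] by (metis ennreal_less_top infinity_ennreal_def order.strict_trans)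
    note alc = timelike_imp_causal[OF al(2)] and bec = timelike_imp_causal[OF be(2)]
    \<comment> \<open>On the whole of [a, c] the branches may leave U, so finiteness of their
      lengths uses the comparison neighbourhoods of all points.\<close>
    have loc: "\<exists>U. neighbourhood U x \<and> (\<forall>p\<in>U. \<forall>q\<in>U. tau p q < \<infinity>)" for x
      using curv[of x] comparison_nbhdD(1) by blast
    obtain F where F: "\<And>s u. a \<le> s \<Longrightarrow> s \<le> u \<Longrightarrow> u \<le> c \<Longrightarrow> F s \<le> F u \<and> tau (al s) (al u) = ennreal (F u - F s)"
      using maximal_potential[OF alc] maximal_finite[OF alc _ loc] al(1) unfolding maximal_curve_def by blast
    obtain G where G: "\<And>s u. a \<le> s \<Longrightarrow> s \<le> u \<Longrightarrow> u \<le> c \<Longrightarrow> G s \<le> G u \<and> tau (be s) (be u) = ennreal (G u - G s)"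
      using maximal_potential[OF bec] maximal_finite[OF bec _ loc] be(1) unfolding maximal_curve_def by blast
    have tac: "t \<in> {a..c}" using at c by simp
    obtain D where D: "open D" "t \<in> D" "\<forall>y\<in>{a..c}. y \<in> D \<longrightarrow> al y \<in> V"
      using fd_causal_curve_continuous[OF alc] V(1,2) x(1) tac unfolding continuous_on_topological by metis
    obtain D' where D': "open D'" "t \<in> D'" "\<forall>y\<in>{a..c}. y \<in> D' \<longrightarrow> be y \<in> V"
      using fd_causal_curve_continuous[OF bec] V(1,2) x(2) tac unfolding continuous_on_topological by metis
    obtain e where e: "e > 0" "\<And>y. dist y t < e \<Longrightarrow> y \<in> D \<inter> D'"
      using open_Int[OF D(1) D'(1)] D(2) D'(2) unfolding open_dist by blast
    \<comment> \<open>Truncation keeps the parameters in [a, c], and s0 < t leaves a common initial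
      piece from which the triangles start.\<close>
    define s0 where "s0 = max a (t - e / 2)"
    define s1 where "s1 = min c (t + e / 2)"
    have s01: "a \<le> s0" "s0 < t" "t < s1" "s1 \<le> c" using at c e by (auto simp: s0_def s1_def)
    have near: "dist s t < e" if "s0 \<le> s" "s \<le> s1" for s
      using that e(1) by (auto simp: s0_def s1_def dist_real_def)
    have inV: "al s \<in> V" "be s \<in> V" if "s0 \<le> s" "s \<le> s1" for s
      using D(3) D'(3) e(2)[OF near[OF that]] that s01 by auto
    have al_max: "tau_length tau al u v = tau (al u) (al v)" if "s0 \<le> u" "u < v" "v \<le> s1" for u v
      using tau_length_eq_potential[of u v F tau al] F that s01 by auto
    have be_max: "tau_length tau be u v = tau (be u) (be v)" if "s0 \<le> u" "u < v" "v \<le> s1" for u v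
      using tau_length_eq_potential[of u v G tau be] G that s01 by auto
    have al_tl: "fd_timelike_curve ll al u v" and be_tl: "fd_timelike_curve ll be u v"
      if "s0 \<le> u" "u < v" "v \<le> s1" for u v
      using timelike_curve_restrict[OF al(2), of u v] timelike_curve_restrict[OF be(2), of u v] that s01 finV inV
      by auto
    have start: "al s0 = be s0" using same s01 by simp
    have "local_branching ll le tau V al be s0 t s1"
    proof unfold_locales
      show "\<And>p q r. p \<in> V \<Longrightarrow> q \<in> V \<Longrightarrow> le p r \<Longrightarrow> le r q \<Longrightarrow> r \<in> V"
        using convex by blast
      show "continuous_on (V \<times> V) (case_prod tau)"
        by (rule continuous_on_subset[OF comparison_nbhdD(2)[OF U(2)] Sigma_mono[OF VU VU]])
      have "al ` {t..s1} \<inter> be ` {t..s1} \<subseteq> al ` {t..c} \<inter> be ` {t..c}" using s01 by (intro Int_mono image_mono) auto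
      moreover have "al t \<in> al ` {t..s1}" "be t \<in> be ` {t..s1}" using s01 by auto
      ultimately show "al ` {t..s1} \<inter> be ` {t..s1} = {al t}" using branch x unfolding x_def by auto
      fix s r assume sr: "t < s" "s \<le> s1" "t < r" "r \<le> s1" "ll (al s) (be r)"
      \<comment> \<open>The triangle has vertices \<open>al s0\<close>, \<open>al s\<close>,
        \<open>be r\<close>; its sides along al and be share the arc up to the branching point,
        which is the common point at parameter t on both.\<close>
      show "tau (al s0) (be r) = tau (al s0) (al s) + tau (al s) (be r)"
      proof (rule degenerate_if_sides_overlap[where K = K and U = U and \<delta> = \<delta> and al = al and be = be
            and ?a1.0 = s0 and ?b1.0 = s and ?a2.0 = s0 and ?b2.0 = r and s = t and r = t])
        show "comparison_nbhd K U" by (rule U(2))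
        show "strict_model_triangle K a b c u \<and> timelike_size_bounds K a b c"
          if "0 < a" "0 < b" "a + b < c" "c < \<delta>" "0 < u" "u < a" for a b c u
          using small that by blast
        show "fd_causal_curve le al s0 s" "fd_causal_curve le be s0 r"
          using al_tl be_tl timelike_imp_causal sr s01 by auto
        show "al ` {s0..s} \<subseteq> U" "be ` {s0..r} \<subseteq> U" using inV VU sr by auto
        show "ll (al s0) (al t)" "ll (al t) (al s)"
          using al_tl[of s0 s1] sr s01 unfolding fd_timelike_curve_def by auto
        show "tau (al s0) (be r) < ennreal \<delta>" using tauV inV sr s01 by auto
      qed (use al_max be_max sr s01 start x in auto)
    qed (use finV s01 al_tl be_tl inV al_max be_max start x in auto)
    then show False using contra V(3) W0(3) by blast
  qed
  show False
    using assms(4)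
  proof
    assume "condition_i ll le tau"
    then obtain W C where W: "neighbourhood W x" and W_closed: "compact (closure W)" "causally_closed le W" and longer:
      "\<forall>p\<in>W. \<forall>q\<in>W. ll p q \<longrightarrow>
         (\<exists>g a b. fd_timelike_curve ll g a b \<and> maximal_curve tau g a b \<and>
                  g a = p \<and> g b = q \<and> g ` {a..b} \<subseteq> W \<and>
                  (\<forall>h a' b'. fd_causal_curve le h a' b' \<and> h a' = p \<and> h b' = q \<and>
                     h ` {a'..b'} \<subseteq> W \<and> contains_null_segment ll le h a' b' \<longrightarrow>
                     tau_length tau h a' b' < tau_length tau g a b))"
      and C: "C > 0" "\<forall>h a b. fd_causal_curve le h a b \<and> h ` {a..b} \<subseteq> W \<longrightarrow> d_length h a b \<le> ennreal C"
      unfolding condition_i_def by metis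
    show False
    proof (rule no_branching[OF W])
      fix V s0 s1 assume lb: "local_branching ll le tau V al be s0 t s1" "V \<subseteq> W"
      show False
        by (rule local_branching.no_strictly_longer_timelike_curves[OF lb W_closed longer[rule_format] C(1)])
          (use C(2) in blast)+
    qed
  next
    assume "timelike_locally_uniquely_geodesic ll le tau"
    then obtain W where W: "neighbourhood W x" and uni: "\<forall>p\<in>W. \<forall>q\<in>W. ll p q \<longrightarrow>
         (\<exists>g a b. fd_causal_curve le g a b \<and> maximal_curve tau g a b \<and>
                  g a = p \<and> g b = q \<and> g ` {a..b} \<subseteq> W) \<and>
         (\<forall>g a b h a' b'.
            fd_causal_curve le g a b \<and> maximal_curve tau g a b \<and> g a = p \<and> g b = q \<and> g ` {a..b} \<subseteq> W \<and>
            fd_causal_curve le h a' b' \<and> maximal_curve tau h a' b' \<and> h a' = p \<and> h b' = q \<and> h ` {a'..b'} \<subseteq> W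
            \<longrightarrow> g ` {a..b} = h ` {a'..b'})"
      unfolding timelike_locally_uniquely_geodesic_def by (elim allE[of _ x] exE conjE) (rule that)
    show False
    proof (rule no_branching[OF W])
      fix V s0 s1 assume lb: "local_branching ll le tau V al be s0 t s1" "V \<subseteq> W"
      show False
        by (rule local_branching.not_uniquely_geodesic[OF lb uni])
    qed
  qed
qed

end
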